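(* Let $(X_\sigma,f_\sigma)_{\sigma\in A}$ be a combinatorial Seshadri stratification on $X_P$, with associated quasi-valuation $\nu$. Let $g\in\mathbb K[\hat X_P]\setminus\{0\}$ be a $\hat T$-eigenfunction of weight $\lambda_g$ with $\deg g\geq 1$, and let $\mathfrak C=(\sigma_r,\ldots,\sigma_0)$ be a maximal chain in $A$. The following are equivalent: i) $\nu(g)=\nu_{\mathfrak C}(g)$; ii) $\frac{-\lambda_g}{\deg g}\in\Delta_{\mathfrak C}$; iii) $\nu_{\mathfrak C}(g)\in\mathbb Q^{\mathfrak C}_{\ge0}$. In particular, $\nu(g)\in\mathbb Q^A_{\ge0}$, and $\nu(g)$ is independent of the choice of the linearization $>^t$.
   Context: Toric variety. $\mathbb K$ is an algebraically closed field of characteristic zero, $T\simeq(\mathbb K^* )^n$ is a torus with character lattice $M$, $M_{\mathbb R}=M\otimes_{\mathbb Z}\mathbb R$. $P\subseteq M_{\mathbb R}$ is a full dimensional normal lattice polytope, $\Lambda=P\cap M$, $V=\mathbb K^\Lambda$ with standard basis $\{e_\chi\}_{\chi\in\Lambda}$ and dual coordinates $x_\chi$. $X_P\subseteq\mathbb P(V)$ is the Zariski closure of the image of $T\to\mathbb P(V)$, $t\mapsto[\sum_{\chi\in\Lambda}\chi(t)e_\chi]$; $\hat X_P\subseteq V$ is its affine cone and $\mathbb K[\hat X_P]$ the coordinate ring of the cone (the homogeneous coordinate ring of $X_P$), graded by degree. $\hat T=\mathbb K^*\times T$, with character lattice $\hat M=\mathbb Z\oplus M$, acts on $V$ by $(c,t)\cdot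 e_\chi=c\chi(t)e_\chi$ and on functions by $(\hat t\cdot g)(x)=g(\hat t^{-1}x)$; so $x_\chi|_{\hat X_P}$ has weight $(-1,-\chi)$. A (nonzero) $\hat T$-eigenfunction $g$ is homogeneous and its weight $\lambda_g$ has first entry $-\deg g$. $M_{\mathbb R}$ is identified with $\{1\}\times M_{\mathbb R}\subset\mathbb R\oplus M_{\mathbb R}$. Stratification and triangulation. $A$ is the set of (nonempty) faces of $P$, including $P$, ordered by inclusion; $\sigma^o$ is the relative interior of $\sigma$; $X_\sigma$ is the Zariski closure of the $T$-orbit $\{[\sum_{\chi\in\Lambda\cap\sigma}\chi(t)e_\chi]\mid t\in T\}$. A combinatorial Seshadri stratification on $X_P$ is a collection $(X_\sigma,f_\sigma)_{\sigma\in A}$ where each $f_\sigma\in\mathbb K[\hat X_P]\setminus\{0\}$ is a $\hat T$-eigenfunction with $\deg f_\sigma\ge1$ whose $\hat T$-weight $\mu_\sigma$ satisfies $\frac{-\mu_\sigma}{\deg f_\sigma}\in\sigma^o$. For a maximal chain $\mathfrak C$ in $A$, $\Delta_{\mathfrak C}$ is the simplex which is the convex hull of the points $\frac{-\mu_\sigma}{\deg f_\sigma}$, $\sigma\in\mathfrak C$. Quasi-valuation. For a maximal chain $\mathfrak C=\{\sigma_r>\dots>\sigma_0\}$ in $A$ the weights $\mu_{\sigma_r},\dots,\mu_{\sigma_0}$ form a $\mathbb Q$-basis of $\hat M_{\mathbb Q}$. $\mathbb Q^{\mathfrak C}$ is the subspace of $\mathbb Q^A$ (standard basis $e_\sigma$,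 $\sigma\in A$) spanned by $e_\sigma$, $\sigma\in\mathfrak C$. For a $\hat T$-eigenfunction $g$ of weight $\lambda_g=\sum_i a_i\mu_{\sigma_i}$ put $\nu_{\mathfrak C}(g)=\sum_i a_ie_{\sigma_i}$; for general $g\ne0$ take the minimum of the values on the $\hat T$-weight components of $g$. The minimum is with respect to the lexicographic order on $\mathbb Q^A$ induced by a fixed total order $>^t$ on $A$ refining the partial order (a "linearization"; the coordinate at the $>^t$-largest element is compared first). The quasi-valuation is $\nu(g)=\min\{\nu_{\mathfrak C}(g)\mid\mathfrak C\text{ a maximal chain in }A\}$. *)

theory Defs
  imports
    "HOL-Analysis.Analysis"
    "HOL-Library.Poly_Mapping"
    "HOL-Computational_Algebra.Computational_Algebra"
begin

section \<open>Normal lattice polytopes\<close>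

text \<open>
  The character lattice of the torus \<open>T = (K\<^sup>*)\<^sup>n\<close> is \<open>M = int^'n\<close>, sitting inside
  \<open>M\<^sub>R = real^'n\<close>; the character attached to \<open>m\<close> is the Laurent monomial with exponent vector \<open>m\<close>.
\<close>

definition lat_emb :: "int^'n \<Rightarrow> real^'n" where
  "lat_emb m = (\<chi> i. real_of_int (m $ i))"

definition lattice_points :: "(real^'n) set \<Rightarrow> (int^'n) set" where
  "lattice_points S = {m. lat_emb m \<in> S}"

definition lattice_polytope :: "(real^'n) set \<Rightarrow> bool" where
  "lattice_polytope P \<longleftrightarrow> (\<exists>S. finite S \<and> P = convex hull (lat_emb ` S))"

abbreviation dilate :: "nat \<Rightarrow> (real^'n) set \<Rightarrow> (real^'n) set" where
  "dilate k P \<equiv> (\<lambda>x. real k *\<^sub>R x) ` P"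

definition normal_lattice_polytope :: "(real^'n) set \<Rightarrow> bool" where
  "normal_lattice_polytope P \<longleftrightarrow> lattice_polytope P \<and>
     (\<forall>k l. {a + b | a b. a \<in> lattice_points (dilate k P) \<and> b \<in> lattice_points (dilate l P)}
            = lattice_points (dilate (k + l) P))"

definition faces :: "(real^'n) set \<Rightarrow> (real^'n) set set" where
  "faces P = {\<sigma>. \<sigma> face_of P \<and> \<sigma> \<noteq> {}}"


section \<open>The tori and their characters\<close>

definition torus :: "('k::field ^ 'n) set" where
  "torus = {t. \<forall>i. t $ i \<noteq> 0}"

definition character :: "int^'n \<Rightarrow> 'k::field ^ 'n \<Rightarrow> 'k" where
  "character m t = (\<Prod>i\<in>UNIV. (t $ i) powi (m $ i))"

definition hat_torus :: "('k::field \<times> ('k^'n)) set" where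
  "hat_torus = (UNIV - {0}) \<times> torus"

definition hat_inv :: "'k::field \<times> ('k^'n) \<Rightarrow> 'k \<times> ('k^'n)" where
  "hat_inv u = (inverse (fst u), \<chi> i. inverse (snd u $ i))"

definition hat_character :: "int \<times> (int^'n) \<Rightarrow> 'k::field \<times> ('k^'n) \<Rightarrow> 'k" where
  "hat_character w u = fst u powi fst w * character (snd w) (snd u)"

definition hat_emb :: "int \<times> (int^'n) \<Rightarrow> real \<times> (real^'n)" where
  "hat_emb w = (real_of_int (fst w), lat_emb (snd w))"


section \<open>Polynomial functions on the ambient space and the toric variety\<close>

text \<open>
  \<open>V = K\<^sup>\<Lambda>\<close>, with \<open>\<Lambda>\<close> the set of lattice points of \<open>P\<close>, consists of the functions on \<open>M\<close> vanishing
  outside \<open>\<Lambda>\<close>.  Polynomials in the coordinates \<open>x\<^sub>m\<close> are finitely supported maps from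
  exponent vectors to coefficients.
\<close>

type_synonym ('n, 'k) vect = "int^'n \<Rightarrow> 'k"
type_synonym ('n, 'k) mpoly = "((int^'n) \<Rightarrow>\<^sub>0 nat) \<Rightarrow>\<^sub>0 'k"

definition ambient :: "(real^'n) set \<Rightarrow> ('n, 'k::field) vect set" where
  "ambient P = {v. \<forall>m. m \<notin> lattice_points P \<longrightarrow> v m = 0}"

definition polys :: "(real^'n) set \<Rightarrow> ('n, 'k::field) mpoly set" where
  "polys P = {F. \<forall>e \<in> Poly_Mapping.keys F. Poly_Mapping.keys e \<subseteq> lattice_points P}"

definition hom_polys :: "(real^'n) set \<Rightarrow> nat \<Rightarrow> ('n, 'k::field) mpoly set" where
  "hom_polys P d = {F \<in> polys P. \<forall>e \<in> Poly_Mapping.keys F. (\<Sum>m\<in>Poly_Mapping.keys e. Poly_Mapping.lookup e m) = d}"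

definition poly_eval :: "('n, 'k::field) mpoly \<Rightarrow> ('n, 'k) vect \<Rightarrow> 'k" where
  "poly_eval F v = (\<Sum>e\<in>Poly_Mapping.keys F. Poly_Mapping.lookup F e * (\<Prod>m\<in>Poly_Mapping.keys e. v m ^ Poly_Mapping.lookup e m))"

text \<open>Points of the projective space of \<open>V\<close> are the lines through the origin.\<close>

definition line_through :: "('n, 'k::field) vect \<Rightarrow> ('n, 'k) vect set" where
  "line_through v = {(\<lambda>m. c * v m) | c. True}"

definition proj_space :: "(real^'n) set \<Rightarrow> ('n, 'k::field) vect set set" where
  "proj_space P = {line_through v | v. v \<in> ambient P \<and> v \<noteq> (\<lambda>_. 0)}"

definition vanishes_on :: "('n, 'k::field) mpoly \<Rightarrow> ('n, 'k) vect set set \<Rightarrow> bool" where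
  "vanishes_on F S \<longleftrightarrow> (\<forall>L\<in>S. \<forall>v\<in>L. poly_eval F v = 0)"

definition proj_zariski_closure ::
    "(real^'n) set \<Rightarrow> ('n, 'k::field) vect set set \<Rightarrow> ('n, 'k) vect set set" where
  "proj_zariski_closure P S =
     {L \<in> proj_space P. \<forall>d. \<forall>F \<in> hom_polys P d. vanishes_on F S \<longrightarrow> vanishes_on F {L}}"

definition orbit_vector :: "(real^'n) set \<Rightarrow> (real^'n) set \<Rightarrow> 'k::field ^ 'n \<Rightarrow> ('n, 'k) vect" where
  "orbit_vector P \<sigma> t = (\<lambda>m. if m \<in> lattice_points P \<inter> lattice_points \<sigma> then character m t else 0)"

definition toric_stratum :: "(real^'n) set \<Rightarrow> (real^'n) set \<Rightarrow> ('n, 'k::field) vect set set" where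
  "toric_stratum P \<sigma> = proj_zariski_closure P ((\<lambda>t. line_through (orbit_vector P \<sigma> t)) ` torus)"

definition toric_variety :: "(real^'n) set \<Rightarrow> ('n, 'k::field) vect set set" where
  "toric_variety P = toric_stratum P P"

definition affine_cone :: "(real^'n) set \<Rightarrow> ('n, 'k::field) vect set" where
  "affine_cone P = insert (\<lambda>_. 0) (\<Union>(toric_variety P))"


section \<open>The homogeneous coordinate ring and torus eigenfunctions\<close>

text \<open>
  Elements of the coordinate ring of the cone are the restrictions of polynomial functions to the
  cone, extended by zero, so that equality of functions is equality on the cone.
\<close>

type_synonym ('n, 'k) cfun = "('n, 'k) vect \<Rightarrow> 'k"

definition restrict_cone ::
    "(real^'n) set \<Rightarrow> ('n, 'k::field) cfun \<Rightarrow> ('n, 'k) cfun" where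
  "restrict_cone P g = (\<lambda>v. if v \<in> affine_cone P then g v else 0)"

definition coord_ring :: "(real^'n) set \<Rightarrow> ('n, 'k::field) cfun set" where
  "coord_ring P = (\<lambda>F. restrict_cone P (poly_eval F)) ` polys P"

definition coord_ring_part :: "(real^'n) set \<Rightarrow> nat \<Rightarrow> ('n, 'k::field) cfun set" where
  "coord_ring_part P d = (\<lambda>F. restrict_cone P (poly_eval F)) ` hom_polys P d"

text \<open>Only meaningful for nonzero homogeneous \<open>g\<close>, for which the degree is unique.\<close>

definition cone_degree :: "(real^'n) set \<Rightarrow> ('n, 'k::field) cfun \<Rightarrow> nat" where
  "cone_degree P g = (THE d. g \<in> coord_ring_part P d)"

definition hat_act :: "'k::field \<times> ('k^'n) \<Rightarrow> ('n, 'k) vect \<Rightarrow> ('n, 'k) vect" where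
  "hat_act u v = (\<lambda>m. fst u * character m (snd u) * v m)"

definition hat_act_fun :: "'k::field \<times> ('k^'n) \<Rightarrow> ('n, 'k) cfun \<Rightarrow> ('n, 'k) cfun" where
  "hat_act_fun u g = (\<lambda>v. g (hat_act (hat_inv u) v))"

definition weight_space ::
    "(real^'n) set \<Rightarrow> int \<times> (int^'n) \<Rightarrow> ('n, 'k::field) cfun set" where
  "weight_space P w = {g \<in> coord_ring P.
     \<forall>u \<in> hat_torus. \<forall>v \<in> affine_cone P. hat_act_fun u g v = hat_character w u * g v}"

definition eigenfunction :: "(real^'n) set \<Rightarrow> ('n, 'k::field) cfun \<Rightarrow> bool" where
  "eigenfunction P g \<longleftrightarrow> g \<noteq> (\<lambda>_. 0) \<and> (\<exists>w. g \<in> weight_space P w)"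

definition weight :: "(real^'n) set \<Rightarrow> ('n, 'k::field) cfun \<Rightarrow> int \<times> (int^'n)" where
  "weight P g = (THE w. g \<in> weight_space P w)"

definition normalized_weight :: "(real^'n) set \<Rightarrow> ('n, 'k::field) cfun \<Rightarrow> real \<times> (real^'n)" where
  "normalized_weight P g = (1 / real (cone_degree P g)) *\<^sub>R (- hat_emb (weight P g))"

definition weight_decomposition ::
    "(real^'n) set \<Rightarrow> ('n, 'k::field) cfun \<Rightarrow> int \<times> (int^'n) \<Rightarrow> ('n, 'k) cfun" where
  "weight_decomposition P g = (THE h. (\<forall>w. h w \<in> weight_space P w) \<and>
     finite {w. h w \<noteq> (\<lambda>_. 0)} \<and>
     g = (\<lambda>v. \<Sum>w | h w \<noteq> (\<lambda>_. 0). h w v))"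

definition weight_components :: "(real^'n) set \<Rightarrow> ('n, 'k::field) cfun \<Rightarrow> ('n, 'k) cfun set" where
  "weight_components P g = range (weight_decomposition P g) - {\<lambda>_. 0}"


section \<open>Combinatorial Seshadri stratifications\<close>

definition combinatorial_seshadri_stratification ::
    "(real^'n) set \<Rightarrow> ((real^'n) set \<Rightarrow> ('n, 'k::field) vect set set) \<Rightarrow>
     ((real^'n) set \<Rightarrow> ('n, 'k) cfun) \<Rightarrow> bool" where
  "combinatorial_seshadri_stratification P X f \<longleftrightarrow>
     (\<forall>\<sigma> \<in> faces P.
        X \<sigma> = toric_stratum P \<sigma> \<and>
        eigenfunction P (f \<sigma>) \<and>
        cone_degree P (f \<sigma>) \<ge> 1 \<and>
        normalized_weight P (f \<sigma>) \<in> {1} \<times> rel_interior \<sigma>)"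

definition chain_simplex ::
    "(real^'n) set \<Rightarrow> ((real^'n) set \<Rightarrow> ('n, 'k::field) cfun) \<Rightarrow> (real^'n) set set \<Rightarrow>
     (real \<times> (real^'n)) set" where
  "chain_simplex P f C = convex hull ((\<lambda>\<sigma>. normalized_weight P (f \<sigma>)) ` C)"


section \<open>The quasi-valuation\<close>

text \<open>
  Vectors in \<open>\<rat>\<^sup>A\<close> are functions on sets vanishing outside \<open>A\<close>.  A linearization is a total order
  \<open>r\<close> on the faces, \<open>(\<sigma>, \<tau>) \<in> r\<close> meaning that \<open>\<sigma>\<close> is at most \<open>\<tau>\<close>.
\<close>

type_synonym 'n qvec = "(real^'n) set \<Rightarrow> rat"

definition linearization :: "(real^'n) set \<Rightarrow> (real^'n) set rel \<Rightarrow> bool" where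
  "linearization P r \<longleftrightarrow> linear_order_on (faces P) r \<and>
     (\<forall>\<sigma> \<in> faces P. \<forall>\<tau> \<in> faces P. \<sigma> \<subseteq> \<tau> \<longrightarrow> (\<sigma>, \<tau>) \<in> r)"

definition lex_less :: "(real^'n) set \<Rightarrow> (real^'n) set rel \<Rightarrow> 'n qvec \<Rightarrow> 'n qvec \<Rightarrow> bool" where
  "lex_less P r a b \<longleftrightarrow>
     (\<exists>\<sigma> \<in> faces P. a \<sigma> < b \<sigma> \<and> (\<forall>\<tau> \<in> faces P. (\<sigma>, \<tau>) \<in> r \<and> \<tau> \<noteq> \<sigma> \<longrightarrow> a \<tau> = b \<tau>))"

definition lex_min :: "(real^'n) set \<Rightarrow> (real^'n) set rel \<Rightarrow> 'n qvec set \<Rightarrow> 'n qvec" where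
  "lex_min P r S = (THE a. a \<in> S \<and> (\<forall>b \<in> S. b \<noteq> a \<longrightarrow> lex_less P r a b))"

definition qspace :: "(real^'n) set set \<Rightarrow> 'n qvec set" where
  "qspace C = {a. \<forall>\<sigma>. \<sigma> \<notin> C \<longrightarrow> a \<sigma> = 0}"

definition qspace_nonneg :: "(real^'n) set set \<Rightarrow> 'n qvec set" where
  "qspace_nonneg C = {a \<in> qspace C. \<forall>\<sigma>\<in>C. a \<sigma> \<ge> 0}"

text \<open>For an eigenfunction \<open>g\<close>; the linear relation between rational weights is written in real scalars.\<close>

definition chain_coords ::
    "(real^'n) set \<Rightarrow> ((real^'n) set \<Rightarrow> ('n, 'k::field) cfun) \<Rightarrow> (real^'n) set set \<Rightarrow>
     ('n, 'k) cfun \<Rightarrow> 'n qvec" where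
  "chain_coords P f C g = (THE a. a \<in> qspace C \<and>
     hat_emb (weight P g) = (\<Sum>\<sigma>\<in>C. of_rat (a \<sigma>) *\<^sub>R hat_emb (weight P (f \<sigma>))))"

definition chain_valuation ::
    "(real^'n) set \<Rightarrow> ((real^'n) set \<Rightarrow> ('n, 'k::field) cfun) \<Rightarrow> (real^'n) set rel \<Rightarrow>
     (real^'n) set set \<Rightarrow> ('n, 'k) cfun \<Rightarrow> 'n qvec" where
  "chain_valuation P f r C g = lex_min P r (chain_coords P f C ` weight_components P g)"

definition quasi_valuation ::
    "(real^'n) set \<Rightarrow> ((real^'n) set \<Rightarrow> ('n, 'k::field) cfun) \<Rightarrow> (real^'n) set rel \<Rightarrow>
     ('n, 'k) cfun \<Rightarrow> 'n qvec" where
  "quasi_valuation P f r g =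
     lex_min P r {chain_valuation P f r C g | C. subset.maxchain (faces P) C}"

end

theory Submission
  imports Defs
begin

text \<open>
  Let \<open>g\<close> be an eigenfunction of weight \<open>\<lambda>\<close> and degree \<open>d \<ge> 1\<close>.  On the dense orbit it is both a
  multiple of one character and a combination of the characters of monomials of degree \<open>d\<close>.  Linear
  independence of characters then shows that \<open>- \<lambda>\<close> is a sum of \<open>d\<close> lattice points of \<open>P\<close>, so that
  \<open>x = - \<lambda> / d\<close> is a point of \<open>P\<close> at height one (\<open>normalized_weight_in_polytope\<close>).  The same
  independence shows that \<open>g\<close> has only one weight and is its only weight component, which identifies
  \<open>chain_valuation P f r C g\<close> with the coordinate vector \<open>chain_coords P f C g\<close>.

  For a maximal chain \<open>C\<close> the points \<open>p \<sigma> = normalized_weight P (f \<sigma>)\<close>, each in the relative interior of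
  its face, are linearly independent (\<open>chain_relation_trivial\<close>), and there are \<open>n + 1\<close> of them
  (\<open>maxchain_spans\<close>).  Up to positive factors \<open>chain_coords P f C g\<close> consists of the barycentric
  coordinates of \<open>x\<close> with respect to them, which gives the equivalence of ii) and iii).

  Some simplex contains \<open>x\<close> (\<open>point_in_chain_simplex\<close>), so nonnegative coordinate vectors exist.  What
  remains is that such a vector is lexicographically least among the coordinate vectors of all maximal
  chains, for each linearization (\<open>nonneg_coords_lex_least\<close>).  Two coordinate vectors \<open>a \<ge> 0\<close>
  and \<open>b\<close>, the second along \<open>C'\<close>, are compared at the topmost face \<open>\<sigma>\<close> where they differ.  The faces
  of \<open>C'\<close> below \<open>\<sigma>\<close>, if any, lie in a single face of \<open>P\<close> that does not contain \<open>\<sigma>\<close>, and a linear functional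
  defining this face (\<open>supporting_functional_of_chain\<close>) rules out \<open>b \<sigma> < a \<sigma>\<close>.  Hence
  the nonnegative coordinate vectors of \<open>g\<close> all coincide with the quasi-valuation, whatever the
  linearization, and no other coordinate vector does.
\<close>

section \<open>Linear independence of characters\<close>

text \<open>
  Dedekind's argument.  Evaluating a relation at a product \<open>x\<cdot>y\<close> and subtracting \<open>\<phi> s x\<close> times
  its value at \<open>y\<close> removes the term of \<open>s\<close> and multiplies the coefficient of every other \<open>w\<close> by
  \<open>\<phi> w x - \<phi> s x\<close>, which is nonzero for a suitable \<open>x\<close>.
\<close>
lemma multiplicative_functions_independent:
  fixes \<phi> :: "'w \<Rightarrow> 'a \<Rightarrow> 'k::field" and c :: "'w \<Rightarrow> 'k"
  assumes "finite S"
    and closed: "\<And>x y. x \<in> T \<Longrightarrow> y \<in> T \<Longrightarrow> mul x y \<in> T"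
    and mult: "\<And>w x y. x \<in> T \<Longrightarrow> y \<in> T \<Longrightarrow> \<phi> w (mul x y) = \<phi> w x * \<phi> w y"
    and distinct: "\<And>w w'. w \<noteq> w' \<Longrightarrow> \<exists>x\<in>T. \<phi> w x \<noteq> \<phi> w' x"
    and nonzero: "\<And>w. \<exists>x\<in>T. \<phi> w x \<noteq> 0"
    and "\<And>x. x \<in> T \<Longrightarrow> (\<Sum>w\<in>S. c w * \<phi> w x) = 0"
    and "w \<in> S"
  shows "c w = 0"
proof -
  have "(\<forall>x\<in>T. (\<Sum>w\<in>S. c w * \<phi> w x) = 0) \<longrightarrow> (\<forall>w\<in>S. c w = 0)" for c
    using \<open>finite S\<close>
  proof (induction S arbitrary: c)
    case empty
    then show ?case by simp
  next
    case (insert s S)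
    show ?case
    proof
      assume rel: "\<forall>x\<in>T. (\<Sum>w\<in>insert s S. c w * \<phi> w x) = 0"
      have S0: "c w = 0" if w: "w \<in> S" for w
      proof -
        obtain x where x: "x \<in> T" "\<phi> w x \<noteq> \<phi> s x"
          using distinct[of w s] insert.hyps w by metis
        have "(\<Sum>w\<in>S. (c w * (\<phi> w x - \<phi> s x)) * \<phi> w y) = 0" if y: "y \<in> T" for y
        proof -
          have "(\<Sum>w\<in>insert s S. c w * \<phi> w (mul x y)) = 0"
            using rel closed[OF x(1) y] by blast
          moreover have "\<phi> s x * (\<Sum>w\<in>insert s S. c w * \<phi> w y) = 0"
            using rel y by simp
          ultimately have "(\<Sum>w\<in>insert s S. c w * \<phi> w (mul x y)) -
              \<phi> s x * (\<Sum>w\<in>insert s S. c w * \<phi> w y) = 0" by simp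
          then show ?thesis
            using insert.hyps
            by (simp add: mult[OF x(1) y] sum_distrib_left flip: sum_subtractf)
               (simp add: algebra_simps sum_subtractf sum_distrib_left)
        qed
        then have "c w * (\<phi> w x - \<phi> s x) = 0"
          using insert.IH[of "\<lambda>w. c w * (\<phi> w x - \<phi> s x)"] w by blast
        then show ?thesis using x(2) by simp
      qed
      obtain x where "x \<in> T" "\<phi> s x \<noteq> 0" using nonzero by blast
      moreover have "(\<Sum>w\<in>S. c w * \<phi> w x) = 0" using S0 by simp
      ultimately have "c s = 0" using rel insert.hyps by fastforce
      then show "\<forall>w\<in>insert s S. c w = 0" using S0 by blast
    qed
  qed
  then show ?thesis using assms(6,7) by blast
qed

lemma character_mult:
  "character m (\<chi> i. x $ i * y $ i) = character m x * character m y"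
  by (simp add: character_def power_int_mult_distrib prod.distrib)

lemma character_one [simp]: "character m (\<chi> i. 1) = 1"
  by (simp add: character_def)

lemma character_nonzero: "t \<in> torus \<Longrightarrow> character m t \<noteq> 0"
  by (simp add: character_def torus_def)

text \<open>
  In characteristic zero the element \<open>2\<close> has infinite order, so it can serve as a coordinate of a
  torus element on which two given characters differ.
\<close>
lemma two_powi_inject:
  assumes "(2::'k::field_char_0) powi a = 2 powi b"
  shows "a = b"
proof -
  have *: "c = 0" if "(2::'k) powi c = 1" "c \<ge> 0" for c
  proof -
    have "of_nat (2 ^ nat c) = (of_nat 1 :: 'k)"
      using that by (simp add: power_int_def)
    then have "(2::nat) ^ nat c = 1" unfolding of_nat_eq_iff .
    then show ?thesis using that(2) by simp
  qed
  have "(2::'k) powi (a - b) = 1" "(2::'k) powi (b - a) = 1"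
    using assms by (simp_all add: power_int_diff)
  then show ?thesis using *[of "a - b"] *[of "b - a"] by linarith
qed

lemma hat_characters_distinct:
  assumes "w \<noteq> w'"
  shows "\<exists>u\<in>hat_torus. hat_character w u \<noteq> (hat_character w' u :: 'k::field_char_0)"
proof (cases "fst w = fst w'")
  case False
  have "(2, \<chi> i. 1) \<in> (hat_torus :: ('k \<times> ('k^'n)) set)"
    by (simp add: hat_torus_def torus_def)
  moreover have "hat_character w (2, \<chi> i. 1) \<noteq> (hat_character w' (2, \<chi> i. 1) :: 'k)"
    using False two_powi_inject by (auto simp: hat_character_def)
  ultimately show ?thesis by blast
next
  case True
  then obtain i where i: "snd w $ i \<noteq> snd w' $ i"
    using assms by (metis prod_eq_iff vec_eq_iff)
  let ?t = "\<chi> j. if j = i then (2::'k) else 1"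
  have c: "character m ?t = 2 powi (m $ i)" for m
    by (simp add: character_def if_distrib[of "\<lambda>x. x powi _"] cong: if_cong)
  have "(1, ?t) \<in> hat_torus" by (simp add: hat_torus_def torus_def)
  moreover have "hat_character w (1, ?t) \<noteq> hat_character w' (1, ?t)"
    using i two_powi_inject by (auto simp: hat_character_def c)
  ultimately show ?thesis by blast
qed

lemma hat_characters_independent:
  fixes c :: "int \<times> (int^'n) \<Rightarrow> 'k::field_char_0"
  assumes "finite S" and "\<And>u. u \<in> hat_torus \<Longrightarrow> (\<Sum>w\<in>S. c w * hat_character w u) = 0"
    and "w \<in> S"
  shows "c w = 0"
proof (rule multiplicative_functions_independent[where \<phi> = hat_character and S = S and T = hat_torus
      and mul = "\<lambda>u u'. (fst u * fst u', \<chi> i. snd u $ i * snd u' $ i)"])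
  fix w show "\<exists>u\<in>hat_torus. hat_character w u \<noteq> (0::'k)"
    by (rule bexI[of _ "(1, \<chi> i. 1)"]) (auto simp: hat_character_def hat_torus_def torus_def)
next
  fix w w' :: "int \<times> (int^'n)" assume "w \<noteq> w'"
  then show "\<exists>u\<in>hat_torus. hat_character w u \<noteq> (hat_character w' u :: 'k)"
    by (rule hat_characters_distinct)
qed (use assms in \<open>auto simp: hat_torus_def torus_def hat_character_def character_mult
    power_int_mult_distrib\<close>)

text \<open>
  Comparison of coefficients: in a sum of characters in which the same character may occur
  repeatedly, the coefficients of each character can be collected.
\<close>
lemma hat_character_coefficient:
  fixes c :: "'i \<Rightarrow> 'k::field_char_0"
  assumes "finite I"
    and "\<And>u. u \<in> hat_torus \<Longrightarrow> (\<Sum>i\<in>I. c i * hat_character (h i) u) = b * hat_character w u"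
  shows "(\<Sum>i | i \<in> I \<and> h i = w. c i) = b"
proof -
  define S where "S = insert w (h ` I)"
  define d where "d w' = (\<Sum>i | i \<in> I \<and> h i = w'. c i) - (if w' = w then b else 0)" for w'
  have fin: "finite S" using assms(1) by (simp add: S_def)
  have "(\<Sum>w'\<in>S. d w' * hat_character w' u) = 0" if u: "u \<in> hat_torus" for u
  proof -
    have "(\<Sum>i\<in>I. c i * hat_character (h i) u) =
        (\<Sum>w'\<in>S. \<Sum>i | i \<in> I \<and> h i = w'. c i * hat_character (h i) u)"
      by (rule sum.group[symmetric]) (use assms(1) fin in \<open>auto simp: S_def\<close>)
    also have "\<dots> = (\<Sum>w'\<in>S. (\<Sum>i | i \<in> I \<and> h i = w'. c i) * hat_character w' u)"
      by (simp add: sum_distrib_right)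
    finally have "(\<Sum>w'\<in>S. (\<Sum>i | i \<in> I \<and> h i = w'. c i) * hat_character w' u) = b * hat_character w u"
      using assms(2)[OF u] by simp
    moreover have "(\<Sum>w'\<in>S. (if w' = w then b else 0) * hat_character w' u) = b * hat_character w u"
      using fin by (simp add: S_def if_distrib[of "\<lambda>x. x * _"] cong: if_cong)
    ultimately show ?thesis by (simp add: d_def left_diff_distrib sum_subtractf)
  qed
  then have "d w = 0" using hat_characters_independent[OF fin, of d w] by (simp add: S_def)
  then show ?thesis by (simp add: d_def)
qed


section \<open>Polynomial functions on the affine cone\<close>

definition monomial :: "((int^'n) \<Rightarrow>\<^sub>0 nat) \<Rightarrow> ('n, 'k::field) vect \<Rightarrow> 'k" where
  "monomial e v = (\<Prod>m\<in>Poly_Mapping.keys e. v m ^ Poly_Mapping.lookup e m)"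

definition total_degree :: "((int^'n) \<Rightarrow>\<^sub>0 nat) \<Rightarrow> nat" where
  "total_degree e = (\<Sum>m\<in>Poly_Mapping.keys e. Poly_Mapping.lookup e m)"

text \<open>
  The character of \<open>hat_torus\<close> by which a monomial changes along the dense orbit; the minus sign
  relating it to the weight of the monomial as an eigenfunction comes from the inverse in
  \<open>hat_act_fun\<close>.
\<close>
definition monomial_character :: "((int^'n) \<Rightarrow>\<^sub>0 nat) \<Rightarrow> int \<times> (int^'n)" where
  "monomial_character e = (int (total_degree e),
     \<chi> i. \<Sum>m\<in>Poly_Mapping.keys e. int (Poly_Mapping.lookup e m) * (m $ i))"

definition homogeneous_part :: "nat \<Rightarrow> ('n::finite, 'k::field) mpoly \<Rightarrow> ('n, 'k) mpoly" where
  "homogeneous_part d F = Poly_Mapping.mapp (\<lambda>e c. if total_degree e = d then c else 0) F"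

lemma poly_eval_monomial:
  "poly_eval F v = (\<Sum>e\<in>Poly_Mapping.keys F. Poly_Mapping.lookup F e * monomial e v)"
  by (simp add: poly_eval_def monomial_def)

lemma monomial_scale: "monomial e (\<lambda>m. c * v m) = c ^ total_degree e * monomial e v"
  by (simp add: monomial_def total_degree_def power_mult_distrib prod.distrib power_sum)

lemma poly_eval_scale:
  assumes "F \<in> hom_polys P d"
  shows "poly_eval F (\<lambda>m. c * v m) = c ^ d * poly_eval F v"
  using assms unfolding hom_polys_def poly_eval_monomial sum_distrib_left
  by (auto intro!: sum.cong simp: monomial_scale simp flip: total_degree_def)

lemma keys_homogeneous_part:
  "Poly_Mapping.keys (homogeneous_part d F) = {e \<in> Poly_Mapping.keys F. total_degree e = d}"
  by (auto simp: homogeneous_part_def in_keys_iff lookup_mapp split: if_splits)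

lemma homogeneous_part_in_hom_polys:
  "F \<in> polys P \<Longrightarrow> homogeneous_part d F \<in> hom_polys P d"
  by (auto simp: hom_polys_def polys_def keys_homogeneous_part total_degree_def)

lemma poly_eval_homogeneous_part:
  "poly_eval (homogeneous_part d F) v =
     (\<Sum>e | e \<in> Poly_Mapping.keys F \<and> total_degree e = d. Poly_Mapping.lookup F e * monomial e v)"
  unfolding poly_eval_monomial keys_homogeneous_part
  by (rule sum.cong) (auto simp: homogeneous_part_def lookup_mapp)

lemma power_of_character:
  "t \<in> torus \<Longrightarrow> character m t ^ k = (\<Prod>i\<in>UNIV. (t $ i) powi (int k * (m $ i)))"
  by (simp add: character_def prod_power_distrib power_int_mult mult.commute[of "int k"])

lemma power_int_sum_exponents:
  "x \<noteq> 0 \<Longrightarrow> x powi (\<Sum>i\<in>A. f i) = (\<Prod>i\<in>A. (x::'k::field) powi f i)"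
  by (induction A rule: infinite_finite_induct) (auto simp: power_int_add)

lemma monomial_orbit_vector:
  assumes "Poly_Mapping.keys e \<subseteq> lattice_points P" and "u \<in> hat_torus"
  shows "monomial e (\<lambda>m. fst u * orbit_vector P P (snd u) m) = hat_character (monomial_character e) u"
proof -
  have t: "snd u \<in> torus" using assms(2) by (auto simp: hat_torus_def)
  then have t0: "snd u $ i \<noteq> 0" for i by (simp add: torus_def)
  have "monomial e (orbit_vector P P (snd u)) =
      (\<Prod>m\<in>Poly_Mapping.keys e. character m (snd u) ^ Poly_Mapping.lookup e m)"
    unfolding monomial_def by (rule prod.cong) (use assms(1) in \<open>auto simp: orbit_vector_def\<close>)
  also have "\<dots> = (\<Prod>i\<in>UNIV. \<Prod>m\<in>Poly_Mapping.keys e.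
      (snd u $ i) powi (int (Poly_Mapping.lookup e m) * (m $ i)))"
    unfolding power_of_character[OF t] by (rule prod.swap)
  also have "\<dots> = character (snd (monomial_character e)) (snd u)"
    by (simp add: character_def monomial_character_def power_int_sum_exponents t0)
  finally show ?thesis
    by (simp add: monomial_scale hat_character_def monomial_character_def)
qed

lemma cone_scale:
  assumes "v \<in> affine_cone P"
  shows "(\<lambda>m. c * v m) \<in> affine_cone P"
proof -
  have "(\<lambda>m. c * v m) \<in> L" if "L \<in> toric_variety P" "v \<in> L" for L
  proof -
    obtain v0 where "L = line_through v0"
      using \<open>L \<in> toric_variety P\<close>
      by (auto simp: toric_variety_def toric_stratum_def proj_zariski_closure_def proj_space_def)
    with that(2) obtain b where "v = (\<lambda>m. b * v0 m)" by (auto simp: line_through_def)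
    then have "(\<lambda>m. c * v m) = (\<lambda>m. (c * b) * v0 m)" by (simp add: mult.assoc)
    then show ?thesis using \<open>L = line_through v0\<close> by (auto simp: line_through_def)
  qed
  then show ?thesis using assms by (auto simp: affine_cone_def)
qed

lemma lattice_polytope_has_lattice_point:
  assumes "lattice_polytope P" "P \<noteq> {}"
  shows "lattice_points P \<noteq> {}"
proof -
  obtain S where S: "P = convex hull (lat_emb ` S)" using assms(1) by (auto simp: lattice_polytope_def)
  then obtain m where "m \<in> S" using assms(2) by auto
  then have "lat_emb m \<in> P" using S by (simp add: hull_inc)
  then show ?thesis by (auto simp: lattice_points_def)
qed

lemma orbit_in_toric_variety:
  assumes "lattice_points P \<noteq> {}" and t: "t \<in> torus"
  shows "line_through (orbit_vector P P t) \<in> toric_variety P"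
proof -
  obtain m where m: "m \<in> lattice_points P" using assms(1) by blast
  then have "orbit_vector P P t m \<noteq> 0" using character_nonzero[OF t] by (simp add: orbit_vector_def)
  then have "orbit_vector P P t \<noteq> (\<lambda>_. 0)" by metis
  moreover have "orbit_vector P P t \<in> ambient P" by (simp add: ambient_def orbit_vector_def)
  ultimately have "line_through (orbit_vector P P t) \<in> proj_space P"
    unfolding proj_space_def by blast
  then show ?thesis
    using t unfolding toric_variety_def toric_stratum_def proj_zariski_closure_def vanishes_on_def
    by blast
qed

lemma orbit_in_cone:
  assumes "lattice_points P \<noteq> {}" "t \<in> torus"
  shows "(\<lambda>m. c * orbit_vector P P t m) \<in> affine_cone P"
  using orbit_in_toric_variety[OF assms] unfolding affine_cone_def line_through_def by blast

text \<open>
  The dense orbit determines a form on the whole cone, since the toric variety is the closure of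
  that orbit with respect to forms.
\<close>
lemma hom_poly_vanishing_on_orbit:
  assumes L: "lattice_points P \<noteq> {}" and F: "F \<in> hom_polys P d"
    and zero: "\<And>t. t \<in> torus \<Longrightarrow> poly_eval F (orbit_vector P P t) = 0"
    and v: "v \<in> affine_cone P"
  shows "poly_eval F v = 0"
proof -
  have "vanishes_on F ((\<lambda>t. line_through (orbit_vector P P t)) ` torus)"
    using zero by (auto simp: vanishes_on_def line_through_def poly_eval_scale[OF F])
  then have van: "poly_eval F w = 0" if "l \<in> toric_variety P" "w \<in> l" for l w
    using that F
    unfolding toric_variety_def toric_stratum_def proj_zariski_closure_def vanishes_on_def by blast
  have one: "(\<chi> i. 1) \<in> torus" by (simp add: torus_def)
  have "(\<lambda>_. 0) \<in> line_through (orbit_vector P P (\<chi> i. 1))"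
    by (auto simp: line_through_def intro: exI[of _ 0])
  then show ?thesis using v van orbit_in_toric_variety[OF L one] unfolding affine_cone_def by blast
qed

section \<open>Torus eigenfunctions\<close>

lemma coord_ring_outside_cone: "g \<in> coord_ring P \<Longrightarrow> v \<notin> affine_cone P \<Longrightarrow> g v = 0"
  by (auto simp: coord_ring_def restrict_cone_def)

lemma weight_space_zero: "((\<lambda>_. 0) :: ('n::finite, 'k::field) cfun) \<in> weight_space P w"
proof -
  have "(\<lambda>_. 0) = restrict_cone P (poly_eval (0 :: ('n, 'k) mpoly))" "(0 :: ('n, 'k) mpoly) \<in> polys P"
    by (auto simp: restrict_cone_def poly_eval_def polys_def)
  then have "((\<lambda>_. 0) :: ('n, 'k) cfun) \<in> coord_ring P" unfolding coord_ring_def by (rule image_eqI)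
  then show ?thesis by (simp add: weight_space_def hat_act_fun_def)
qed

lemma weight_space_act:
  assumes "g \<in> weight_space P w" "u \<in> hat_torus" "v \<in> affine_cone P"
  shows "g (hat_act (hat_inv u) v) = g v * hat_character w u"
  using assms by (simp add: weight_space_def hat_act_fun_def mult.commute)

text \<open>
  At a point \<open>v\<close> of the cone both sides of a decomposition become combinations of characters of
  \<open>hat_torus\<close>, with coefficients \<open>g v\<close> and \<open>h w v\<close>; these agree by linear independence.
\<close>
lemma weight_space_decomposition_unique:
  fixes g :: "('n::finite, 'k::field_char_0) cfun"
  assumes g: "g \<in> weight_space P w0"
    and h: "\<And>w. h w \<in> weight_space P w" and fin: "finite {w. h w \<noteq> (\<lambda>_. 0)}"
    and sum: "g = (\<lambda>v. \<Sum>w | h w \<noteq> (\<lambda>_. 0). h w v)"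
  shows "h = (\<lambda>w. if w = w0 then g else (\<lambda>_. 0))"
proof (intro ext)
  fix w v
  let ?W = "{w. h w \<noteq> (\<lambda>_. 0)}"
  show "h w v = (if w = w0 then g else (\<lambda>_. 0)) v"
  proof (cases "v \<in> affine_cone P")
    case False
    then have "h w v = 0" "g v = 0"
      using coord_ring_outside_cone[OF _ False] h[of w] g unfolding weight_space_def by blast+
    then show ?thesis by simp
  next
    case v: True
    define S where "S = insert w (insert w0 ?W)"
    define c where "c w' = h w' v - (if w' = w0 then g v else 0)" for w'
    have S: "finite S" "?W \<subseteq> S" "w0 \<in> S" "w \<in> S" using fin by (auto simp: S_def)
    have "(\<Sum>w'\<in>S. c w' * hat_character w' u) = 0" if u: "u \<in> hat_torus" for u
    proof -
      have "g v * hat_character w0 u = g (hat_act (hat_inv u) v)"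
        by (simp add: weight_space_act[OF g u v])
      also have "\<dots> = (\<Sum>w'\<in>?W. h w' (hat_act (hat_inv u) v))" by (subst sum) simp
      also have "\<dots> = (\<Sum>w'\<in>?W. h w' v * hat_character w' u)"
        by (simp add: weight_space_act[OF h u v])
      also have "\<dots> = (\<Sum>w'\<in>S. h w' v * hat_character w' u)"
        by (rule sum.mono_neutral_left) (use S in auto)
      finally show ?thesis
        using S(1,3) by (simp add: c_def left_diff_distrib sum_subtractf
            if_distrib[of "\<lambda>x. x * _"] cong: if_cong)
    qed
    then have "c w = 0" using hat_characters_independent[OF S(1) _ S(4), of c] by blast
    then show ?thesis by (auto simp: c_def split: if_splits)
  qed
qed

lemma weight_unique:
  fixes g :: "('n::finite, 'k::field_char_0) cfun"
  assumes "g \<noteq> (\<lambda>_. 0)" "g \<in> weight_space P w"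
  shows "weight P g = w"
  unfolding weight_def
proof (rule the_equality)
  fix w' assume w': "g \<in> weight_space P w'"
  show "w' = w"
  proof (rule ccontr)
    assume "w' \<noteq> w"
    define h where "h = (\<lambda>w''. if w'' = w' then g else (\<lambda>_. 0))"
    have supp: "{w. h w \<noteq> (\<lambda>_. 0)} = {w'}" using assms(1) by (auto simp: h_def)
    have "h = (\<lambda>w''. if w'' = w then g else (\<lambda>_. 0))"
      by (rule weight_space_decomposition_unique[OF assms(2)])
         (simp_all only: supp, simp_all add: h_def w' weight_space_zero)
    then have "h w' = (\<lambda>_. 0)" using \<open>w' \<noteq> w\<close> by simp
    then show False using assms(1) by (simp add: h_def)
  qed
qed (rule assms)

lemma weight_components_eigenfunction:
  fixes g :: "('n::finite, 'k::field_char_0) cfun"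
  assumes "eigenfunction P g"
  shows "weight_components P g = {g}"
proof -
  obtain w where g: "g \<noteq> (\<lambda>_. 0)" "g \<in> weight_space P w"
    using assms by (auto simp: eigenfunction_def)
  define h0 where "h0 = (\<lambda>w'. if w' = w then g else (\<lambda>_. 0))"
  have supp: "{w. h0 w \<noteq> (\<lambda>_. 0)} = {w}" using g(1) by (auto simp: h0_def)
  have "weight_decomposition P g = h0"
    unfolding weight_decomposition_def
  proof (rule the_equality)
    show "(\<forall>w. h0 w \<in> weight_space P w) \<and> finite {w. h0 w \<noteq> (\<lambda>_. 0)} \<and>
        g = (\<lambda>v. \<Sum>w | h0 w \<noteq> (\<lambda>_. 0). h0 w v)"
      unfolding supp by (simp add: h0_def g(2) weight_space_zero)
  qed (use weight_space_decomposition_unique[OF g(2)] in \<open>auto simp: h0_def\<close>)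
  moreover have "range h0 - {\<lambda>_. 0} = {g}" using g(1) by (auto simp: h0_def)
  ultimately show ?thesis by (simp add: weight_components_def)
qed

text \<open>
  The scalars in \<open>hat_torus\<close> act on the degree-\<open>d\<close> part of a polynomial by \<open>d\<close>-th powers, so
  comparing coefficients leaves only one homogeneous part on the cone.  Its degree is the negative
  of the first entry of the weight, which is therefore not positive.
\<close>
lemma eigenfunction_homogeneous:
  fixes g :: "('n::finite, 'k::field_char_0) cfun"
  assumes "eigenfunction P g"
  obtains d F where "F \<in> hom_polys P d" "g = restrict_cone P (poly_eval F)"
    "fst (weight P g) = - int d"
proof -
  obtain w where g: "g \<noteq> (\<lambda>_. 0)" "g \<in> weight_space P w"
    using assms by (auto simp: eigenfunction_def)
  then obtain F where F: "F \<in> polys P" "g = restrict_cone P (poly_eval F)"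
    by (auto simp: weight_space_def coord_ring_def)
  have gF: "g v = poly_eval F v" if "v \<in> affine_cone P" for v
    using that by (simp add: F(2) restrict_cone_def)
  have coeff: "(\<Sum>e | e \<in> Poly_Mapping.keys F \<and> (int (total_degree e), 0 :: int^'n) = (- fst w, 0).
      Poly_Mapping.lookup F e * monomial e v) = g v" if v: "v \<in> affine_cone P" for v
  proof (rule hat_character_coefficient)
    fix u :: "'k \<times> ('k^'n)" assume u: "u \<in> hat_torus"
    \<comment> \<open>The element of the torus whose inverse acts as multiplication by \<open>fst u\<close>.\<close>
    let ?u = "(inverse (fst u), \<chi> i. 1) :: 'k \<times> ('k^'n)"
    have u': "?u \<in> hat_torus" using u by (auto simp: hat_torus_def torus_def)
    have "hat_act (hat_inv ?u) v = (\<lambda>m. fst u * v m)"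
      by (simp add: hat_act_def hat_inv_def)
    then have "poly_eval F (\<lambda>m. fst u * v m) = g v * hat_character w ?u"
      using weight_space_act[OF g(2) u' v] gF[OF cone_scale[OF v, of "fst u"]] by simp
    also have "hat_character w ?u = hat_character (- fst w, 0) u"
      by (simp add: hat_character_def power_int_inverse power_int_minus character_def)
    finally show "(\<Sum>e\<in>Poly_Mapping.keys F. Poly_Mapping.lookup F e * monomial e v *
        hat_character (int (total_degree e), 0) u) = g v * hat_character (- fst w, 0) u"
      by (simp add: poly_eval_monomial monomial_scale hat_character_def character_def mult_ac)
  qed simp
  obtain v where "g v \<noteq> 0" using g(1) by auto
  moreover from this have "v \<in> affine_cone P"
    using F(2) by (auto simp: restrict_cone_def split: if_splits)
  ultimately have "{e \<in> Poly_Mapping.keys F. (int (total_degree e), 0 :: int^'n) = (- fst w, 0)} \<noteq> {}"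
    using coeff[of v] by (metis (no_types, lifting) sum.empty)
  then have "\<exists>e \<in> Poly_Mapping.keys F. int (total_degree e) = - fst w" by blast
  then obtain d where d: "- fst w = int d" by metis
  have "g = restrict_cone P (poly_eval (homogeneous_part d F))"
  proof
    fix v show "g v = restrict_cone P (poly_eval (homogeneous_part d F)) v"
      using coeff[of v] F(2) by (auto simp: restrict_cone_def poly_eval_homogeneous_part d)
  qed
  moreover have "fst (weight P g) = - int d" using d weight_unique[OF g] by simp
  ultimately show ?thesis using that homogeneous_part_in_hom_polys[OF F(1)] by blast
qed

lemma cone_degree_unique:
  fixes g :: "('n::finite, 'k::field_char_0) cfun"
  assumes "g \<noteq> (\<lambda>_. 0)" "F \<in> hom_polys P d" "g = restrict_cone P (poly_eval F)"
  shows "cone_degree P g = d"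
  unfolding cone_degree_def
proof (rule the_equality)
  show "g \<in> coord_ring_part P d" using assms(2,3) by (auto simp: coord_ring_part_def)
  fix d' assume "g \<in> coord_ring_part P d'"
  then obtain F' where F': "F' \<in> hom_polys P d'" "g = restrict_cone P (poly_eval F')"
    by (auto simp: coord_ring_part_def)
  obtain v where v: "g v \<noteq> 0" using assms(1) by auto
  then have vc: "v \<in> affine_cone P" using assms(3) by (auto simp: restrict_cone_def split: if_splits)
  have "g (\<lambda>m. 2 * v m) = 2 ^ k * g v"
    if "G \<in> hom_polys P k" "g = restrict_cone P (poly_eval G)" for G k
    unfolding that(2) using vc cone_scale[OF vc, of 2] poly_eval_scale[OF that(1)]
    by (simp add: restrict_cone_def)
  from this[OF assms(2,3)] this[OF F'] have "(2::'k) powi int d' = 2 powi int d" using v by simp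
  then show "d' = d" using two_powi_inject by fastforce
qed

lemma cone_degree_weight:
  fixes g :: "('n::finite, 'k::field_char_0) cfun"
  assumes "eigenfunction P g"
  shows "fst (weight P g) = - int (cone_degree P g)"
proof -
  obtain d F where F: "F \<in> hom_polys P d" "g = restrict_cone P (poly_eval F)"
    "fst (weight P g) = - int d"
    using eigenfunction_homogeneous[OF assms] .
  then show ?thesis using cone_degree_unique[OF _ F(1,2)] assms by (simp add: eigenfunction_def)
qed

text \<open>
  Restricted to the dense orbit, an eigenfunction of weight \<open>w\<close> is a multiple of the character
  \<open>- w\<close>, and not the zero multiple because the orbit is dense.  On the other hand it is a
  combination of the characters of its monomials, so \<open>- w\<close> is one of them.
\<close>
lemma weight_is_monomial_character:
  fixes g :: "('n::finite, 'k::field_char_0) cfun"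
  assumes L: "lattice_points P \<noteq> {}" and "eigenfunction P g"
  obtains e where "Poly_Mapping.keys e \<subseteq> lattice_points P" "monomial_character e = - weight P g"
proof -
  obtain w where g: "g \<noteq> (\<lambda>_. 0)" "g \<in> weight_space P w"
    using assms(2) by (auto simp: eigenfunction_def)
  obtain d F where F: "F \<in> hom_polys P d" "g = restrict_cone P (poly_eval F)"
    using eigenfunction_homogeneous[OF assms(2)] .
  have keys: "Poly_Mapping.keys e \<subseteq> lattice_points P" if "e \<in> Poly_Mapping.keys F" for e
    using F(1) that by (auto simp: hom_polys_def polys_def)
  define v1 :: "('n, 'k) vect" where "v1 = orbit_vector P P (\<chi> i. 1)"
  have one: "(\<chi> i. 1) \<in> (torus :: ('k^'n) set)" by (simp add: torus_def)
  have v1: "v1 \<in> affine_cone P"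
    using orbit_in_cone[OF L one, of 1] by (simp add: v1_def)
  have val: "poly_eval F (\<lambda>m. fst u * orbit_vector P P (snd u) m) = g v1 * hat_character (- w) u"
    if u: "u \<in> hat_torus" for u
  proof -
    have u': "hat_inv u \<in> hat_torus" using u by (auto simp: hat_torus_def torus_def hat_inv_def)
    have act: "hat_act (hat_inv (hat_inv u)) v1 = (\<lambda>m. fst u * orbit_vector P P (snd u) m)"
      by (auto simp: hat_act_def hat_inv_def v1_def orbit_vector_def)
    have "(\<lambda>m. fst u * orbit_vector P P (snd u) m) \<in> affine_cone P"
      using orbit_in_cone[OF L, of "snd u" "fst u"] u by (auto simp: hat_torus_def)
    then have "poly_eval F (\<lambda>m. fst u * orbit_vector P P (snd u) m) = g v1 * hat_character w (hat_inv u)"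
      using weight_space_act[OF g(2) u' v1] unfolding act by (simp add: F(2) restrict_cone_def)
    also have "hat_character w (hat_inv u) = hat_character (- w) u"
      by (simp add: hat_character_def hat_inv_def character_def power_int_inverse power_int_minus)
    finally show ?thesis .
  qed
  have "g v1 \<noteq> 0"
  proof
    assume "g v1 = 0"
    then have "poly_eval F (orbit_vector P P t) = 0" if "t \<in> torus" for t
      using val[of "(1, t)"] that by (simp add: hat_torus_def)
    then have "g v = 0" for v
      using hom_poly_vanishing_on_orbit[OF L F(1), of v] by (simp add: F(2) restrict_cone_def)
    then show False using g(1) by auto
  qed
  moreover have "(\<Sum>e | e \<in> Poly_Mapping.keys F \<and> monomial_character e = - w. Poly_Mapping.lookup F e) = g v1"
  proof (rule hat_character_coefficient)
    fix u :: "'k \<times> ('k^'n)" assume u: "u \<in> hat_torus"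
    show "(\<Sum>e\<in>Poly_Mapping.keys F. Poly_Mapping.lookup F e * hat_character (monomial_character e) u) =
        g v1 * hat_character (- w) u"
      using val[OF u] monomial_orbit_vector[OF keys u] by (simp add: poly_eval_monomial)
  qed simp
  ultimately have "{e \<in> Poly_Mapping.keys F. monomial_character e = - w} \<noteq> {}"
    by (metis (no_types, lifting) sum.empty)
  then show ?thesis using that keys weight_unique[OF g] by blast
qed

text \<open>
  A monomial of degree \<open>d\<close> is a product of \<open>d\<close> coordinates, so its character divided by \<open>d\<close> is the
  average of \<open>d\<close> lattice points of \<open>P\<close>.
\<close>
lemma normalized_weight_in_polytope:
  fixes g :: "('n::finite, 'k::field_char_0) cfun"
  assumes L: "lattice_points P \<noteq> {}" and conv: "convex P"
    and g: "eigenfunction P g" "cone_degree P g \<ge> 1"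
  shows "normalized_weight P g \<in> {1} \<times> P"
proof -
  obtain e where e: "Poly_Mapping.keys e \<subseteq> lattice_points P" "monomial_character e = - weight P g"
    using weight_is_monomial_character[OF L g(1)] .
  define d where "d = cone_degree P g"
  have d: "d > 0" "total_degree e = d"
    using g(2) cone_degree_weight[OF g(1)] e(2)
    by (auto simp: d_def monomial_character_def prod_eq_iff)
  let ?c = "\<lambda>m. real (Poly_Mapping.lookup e m) / real d"
  have "snd (normalized_weight P g) = (1 / real d) *\<^sub>R lat_emb (snd (monomial_character e))"
    unfolding e(2) by (simp add: normalized_weight_def hat_emb_def d_def lat_emb_def vec_eq_iff)
  also have "\<dots> = (\<Sum>m\<in>Poly_Mapping.keys e. ?c m *\<^sub>R lat_emb m)"
    by (simp add: vec_eq_iff lat_emb_def monomial_character_def sum_divide_distrib)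
  also have "\<dots> \<in> P"
  proof (rule convex_sum)
    show "sum ?c (Poly_Mapping.keys e) = 1"
      using d by (simp add: total_degree_def flip: sum_divide_distrib of_nat_sum)
  qed (use e(1) conv in \<open>auto simp: lattice_points_def\<close>)
  moreover have "fst (normalized_weight P g) = 1"
    using d(1) cone_degree_weight[OF g(1)] by (simp add: normalized_weight_def hat_emb_def d_def)
  ultimately show ?thesis by (simp add: mem_Times_iff)
qed


section \<open>Chains of faces of a polytope\<close>

lemma faceD: "\<sigma> \<in> faces P \<Longrightarrow> \<sigma> face_of P" "\<sigma> \<in> faces P \<Longrightarrow> \<sigma> \<noteq> {}" "\<sigma> \<in> faces P \<Longrightarrow> \<sigma> \<subseteq> P"
  by (auto simp: faces_def dest: face_of_imp_subset)

lemma finite_faces: "polytope P \<Longrightarrow> finite (faces P)"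
  by (rule finite_subset[OF _ finite_polytope_faces]) (auto simp: faces_def)

lemma faces_trans: "\<sigma> \<in> faces P \<Longrightarrow> faces \<sigma> \<subseteq> faces P"
  by (auto simp: faces_def intro: face_of_trans)

lemma finite_chain_has_greatest:
  assumes "finite D" "D \<noteq> {}" "subset.chain A D"
  obtains M where "M \<in> D" "\<And>S. S \<in> D \<Longrightarrow> S \<subseteq> M"
proof -
  obtain M where "M \<in> D" "\<And>S. S \<in> D \<Longrightarrow> M \<subseteq> S \<Longrightarrow> M = S"
    using finite_has_maximal[OF assms(1,2)] by metis
  then show ?thesis
    using assms(3) that unfolding subset_chain_def by metis
qed

text \<open>
  Every face of a polytope is exposed.  The largest face \<open>M\<close> of \<open>D\<close> is thus the zero set in \<open>P\<close> of an
  affine function that is nonnegative on \<open>P\<close>, and at height one an affine function on \<open>M\<^sub>R\<close> is a linear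
  functional on \<open>\<real> \<times> M\<^sub>R\<close>.  It is positive at \<open>q \<sigma>\<close>, because a face containing a relative interior
  point of \<open>\<sigma>\<close> contains all of \<open>\<sigma>\<close>.  Independence of the points of a chain and minimality of
  nonnegative coordinates both rest on this functional.
\<close>
lemma supporting_functional_of_chain:
  fixes q :: "(real^'n) set \<Rightarrow> real \<times> (real^'n)"
  assumes P: "polytope P"
    and q: "\<And>\<sigma>. \<sigma> \<in> faces P \<Longrightarrow> q \<sigma> \<in> {1} \<times> rel_interior \<sigma>"
    and D: "subset.chain (faces P) D"
    and \<sigma>: "\<sigma> \<in> faces P"
    and above: "\<And>\<tau>. \<tau> \<in> D \<Longrightarrow> \<not> \<sigma> \<subseteq> \<tau>"
  obtains y where "\<And>\<tau>. \<tau> \<in> D \<Longrightarrow> y \<bullet> q \<tau> = 0"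
    and "\<And>\<tau>. \<tau> \<in> faces P \<Longrightarrow> y \<bullet> q \<tau> \<ge> 0"
    and "y \<bullet> q \<sigma> > 0"
proof (cases "D = {}")
  case True
  \<comment> \<open>Without faces to vanish on, the height itself is positive at all the points.\<close>
  show ?thesis
  proof (rule that[of "(1, 0)"])
    have "(1, 0) \<bullet> q \<tau> = 1" if "\<tau> \<in> faces P" for \<tau>
      using q[OF that] by (auto simp: inner_prod_def)
    then show "(1, 0) \<bullet> q \<tau> \<ge> 0" if "\<tau> \<in> faces P" for \<tau>
      using that by simp
    show "(1, 0) \<bullet> q \<sigma> > 0"
      using \<open>\<And>\<tau>. \<tau> \<in> faces P \<Longrightarrow> (1, 0) \<bullet> q \<tau> = 1\<close>[OF \<sigma>] by simp
  qed (use True in simp)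
next
  case False
  have DA: "D \<subseteq> faces P" using D by (simp add: subset_chain_def)
  obtain M where M: "M \<in> D" "\<And>\<tau>. \<tau> \<in> D \<Longrightarrow> \<tau> \<subseteq> M"
    using finite_chain_has_greatest[OF _ False D] finite_subset[OF DA finite_faces[OF P]] by blast
  have MP: "M face_of P" using M(1) DA faceD by blast
  then obtain a b where ab: "P \<subseteq> {x. a \<bullet> x \<le> b}" "M = P \<inter> {x. a \<bullet> x = b}"
    using exposed_face_of_polyhedron[OF polytope_imp_polyhedron[OF P]]
    unfolding exposed_face_of_def by blast
  have q': "fst (q \<tau>) = 1" "snd (q \<tau>) \<in> rel_interior \<tau>" "snd (q \<tau>) \<in> \<tau>" if "\<tau> \<in> faces P" for \<tau>
    using q[OF that] rel_interior_subset[of \<tau>] by auto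
  have val: "(b, - a) \<bullet> q \<tau> = b - a \<bullet> snd (q \<tau>)" if "\<tau> \<in> faces P" for \<tau>
    using q'[OF that] by (simp add: inner_prod_def)
  show ?thesis
  proof (rule that[of "(b, - a)"])
    fix \<tau> assume "\<tau> \<in> D"
    then have "\<tau> \<in> faces P" "\<tau> \<subseteq> M" using DA M(2) by auto
    then show "(b, - a) \<bullet> q \<tau> = 0"
      using val[of \<tau>] q'(3)[of \<tau>] ab(2) by auto
  next
    fix \<tau> assume \<tau>: "\<tau> \<in> faces P"
    then have "snd (q \<tau>) \<in> P" using q'(3) faceD(3) by blast
    then show "(b, - a) \<bullet> q \<tau> \<ge> 0" using val[OF \<tau>] ab(1) by auto
  next
    have "snd (q \<sigma>) \<in> P" using q'(3) \<sigma> faceD(3) by blast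
    moreover have "snd (q \<sigma>) \<notin> M"
      using subset_of_face_of[OF MP faceD(3)[OF \<sigma>]] q'(2)[OF \<sigma>] above[OF M(1)] by blast
    ultimately have "a \<bullet> snd (q \<sigma>) < b" using ab by force
    then show "(b, - a) \<bullet> q \<sigma> > 0" using val[OF \<sigma>] by simp
  qed
qed

text \<open>
  A supporting functional that vanishes on all smaller faces of the relation isolates the
  coefficient of its largest face.
\<close>
lemma chain_relation_trivial:
  fixes q :: "(real^'n) set \<Rightarrow> real \<times> (real^'n)"
  assumes P: "polytope P"
    and q: "\<And>\<sigma>. \<sigma> \<in> faces P \<Longrightarrow> q \<sigma> \<in> {1} \<times> rel_interior \<sigma>"
    and C: "subset.chain (faces P) C"
    and rel: "(\<Sum>\<sigma>\<in>C. c \<sigma> *\<^sub>R q \<sigma>) = 0"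
    and "\<sigma> \<in> C"
  shows "c \<sigma> = 0"
proof (rule ccontr)
  assume "c \<sigma> \<noteq> 0"
  have CA: "C \<subseteq> faces P" using C by (simp add: subset_chain_def)
  then have fin: "finite C" using finite_faces[OF P] finite_subset by blast
  let ?N = "{\<tau> \<in> C. c \<tau> \<noteq> 0}"
  have sub: "subset.chain (faces P) D" if "D \<subseteq> C" for D
    using C that unfolding subset_chain_def by blast
  have N: "finite ?N" "?N \<noteq> {}" "?N \<subseteq> C" using fin \<open>\<sigma> \<in> C\<close> \<open>c \<sigma> \<noteq> 0\<close> by auto
  obtain M where M: "M \<in> ?N" "\<And>\<tau>. \<tau> \<in> ?N \<Longrightarrow> \<tau> \<subseteq> M"
    using finite_chain_has_greatest[OF N(1,2) sub[OF N(3)]] by blast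
  have "?N - {M} \<subseteq> C" by blast
  note N' = sub[OF this]
  have M': "M \<in> faces P" using M(1) CA by blast
  have above: "\<not> M \<subseteq> \<tau>" if "\<tau> \<in> ?N - {M}" for \<tau> using M(2)[of \<tau>] that by auto
  obtain y where y: "\<And>\<tau>. \<tau> \<in> ?N - {M} \<Longrightarrow> y \<bullet> q \<tau> = 0" "y \<bullet> q M > 0"
    by (rule supporting_functional_of_chain[OF P q N' M' above]) auto
  have "0 = y \<bullet> (\<Sum>\<sigma>\<in>C. c \<sigma> *\<^sub>R q \<sigma>)" using rel by simp
  also have "\<dots> = (\<Sum>\<sigma>\<in>C. c \<sigma> * (y \<bullet> q \<sigma>))" by (simp add: inner_sum_right)
  also have "\<dots> = (\<Sum>\<sigma>\<in>C. if \<sigma> = M then c M * (y \<bullet> q M) else 0)"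
    by (rule sum.cong) (use y in auto)
  also have "\<dots> = c M * (y \<bullet> q M)" using fin M(1) by simp
  finally show False using M(1) y(2) by simp
qed

lemma inj_on_chain:
  fixes q :: "(real^'n) set \<Rightarrow> real \<times> (real^'n)"
  assumes P: "polytope P"
    and q: "\<And>\<sigma>. \<sigma> \<in> faces P \<Longrightarrow> q \<sigma> \<in> {1} \<times> rel_interior \<sigma>"
    and C: "subset.chain (faces P) C"
  shows "inj_on q C"
proof (rule inj_onI, rule ccontr)
  fix \<sigma> \<tau> assume st: "\<sigma> \<in> C" "\<tau> \<in> C" "q \<sigma> = q \<tau>" "\<sigma> \<noteq> \<tau>"
  have "C \<subseteq> faces P" using C by (simp add: subset_chain_def)
  then have fin: "finite C" using finite_faces[OF P] finite_subset by blast
  let ?c = "\<lambda>\<rho>. (if \<rho> = \<sigma> then 1 else 0) - (if \<rho> = \<tau> then 1 else (0::real))"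
  have "(\<Sum>\<rho>\<in>C. ?c \<rho> *\<^sub>R q \<rho>) = 0"
    using st fin by (simp add: scaleR_left_diff_distrib sum_subtractf
        if_distrib[of "\<lambda>x. x *\<^sub>R _"] cong: if_cong)
  from chain_relation_trivial[OF P q C this st(1)] st(4) show False by simp
qed

lemma maxchain_insert:
  fixes A :: "'a set set"
  assumes "subset.maxchain A C" "F \<in> A" "\<And>\<tau>. \<tau> \<in> C \<Longrightarrow> \<tau> \<subseteq> F \<or> F \<subseteq> \<tau>"
  shows "F \<in> C"
proof (rule ccontr)
  assume "F \<notin> C"
  have "subset.chain A (insert F C)"
    using assms(2,3) subset.maxchain_imp_chain[OF assms(1)] unfolding subset_chain_def by blast
  then show False using assms(1) \<open>F \<notin> C\<close> unfolding subset.maxchain_def by blast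
qed

text \<open>
  Below a face of positive dimension a maximal chain continues with a facet of it: the faces of the
  chain strictly below all lie in a common facet, which by maximality belongs to the chain.
\<close>
lemma maxchain_aff_dims:
  fixes P :: "(real^'n) set"
  assumes P: "polytope P" and C: "subset.maxchain (faces P) C"
    and "0 \<le> k" "k \<le> aff_dim P"
  shows "\<exists>\<sigma>\<in>C. aff_dim \<sigma> = k"
proof -
  have ch: "subset.chain (faces P) C" using C by (rule subset.maxchain_imp_chain)
  then have CA: "C \<subseteq> faces P" by (simp add: subset_chain_def)
  have "P \<noteq> {}" using assms(3,4) by auto
  then have "P \<in> faces P" using polytope_imp_convex[OF P] by (simp add: faces_def face_of_refl)
  then have PC: "P \<in> C" using maxchain_insert[OF C] CA faceD(3) by blast
  from assms(4,3) show ?thesis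
  proof (induction k rule: int_le_induct)
    case base
    then show ?case using PC by blast
  next
    case (step k)
    then obtain \<sigma> where \<sigma>: "\<sigma> \<in> C" "aff_dim \<sigma> = k" by force
    have \<sigma>P: "\<sigma> face_of P" using \<sigma> CA faceD by blast
    then have po: "polytope \<sigma>" using P face_of_polytope_polytope by blast
    let ?D = "{\<tau> \<in> C. \<tau> \<subset> \<sigma>}"
    have finD: "finite ?D" using CA finite_faces[OF P] by (auto intro: finite_subset)
    have "\<exists>F. F facet_of \<sigma> \<and> (\<forall>\<tau>\<in>?D. \<tau> \<subseteq> F)"
    proof (cases "?D = {}")
      case True
      have "0 < aff_dim \<sigma>" using \<sigma>(2) step.prems by simp
      then obtain F where "F facet_of \<sigma>" using polytope_facet_exists[OF po] by blast
      then show ?thesis using True by blast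
    next
      case False
      have "subset.chain (faces P) ?D" using ch by (auto simp: subset_chain_def)
      then obtain M where M: "M \<in> ?D" "\<And>\<tau>. \<tau> \<in> ?D \<Longrightarrow> \<tau> \<subseteq> M"
        using finite_chain_has_greatest[OF finD False] by blast
      have "M \<in> faces P" "M \<subseteq> \<sigma>" using M(1) CA by auto
      then have "M face_of \<sigma>" "M \<noteq> {}"
        using faceD face_of_subset[OF _ _ face_of_imp_subset[OF \<sigma>P]] by blast+
      then obtain F where "F facet_of \<sigma>" "M \<subseteq> F"
        using face_of_polyhedron_subset_facet[OF polytope_imp_polyhedron[OF po]] M(1) by blast
      then show ?thesis using M(2) by blast
    qed
    then obtain F where F: "F facet_of \<sigma>" "\<And>\<tau>. \<tau> \<in> ?D \<Longrightarrow> \<tau> \<subseteq> F" by blast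
    have "F \<in> faces P" using F(1) \<sigma>P by (auto simp: facet_of_def faces_def intro: face_of_trans)
    moreover have "F \<subseteq> \<sigma>" using F(1) by (simp add: facet_of_imp_subset)
    moreover have "\<tau> \<subseteq> F \<or> F \<subseteq> \<tau>" if "\<tau> \<in> C" for \<tau>
    proof (cases "\<sigma> \<subseteq> \<tau>")
      case False
      then have "\<tau> \<in> ?D" using ch \<sigma>(1) that unfolding subset_chain_def by auto
      then show ?thesis using F(2) by simp
    qed (use \<open>F \<subseteq> \<sigma>\<close> in auto)
    ultimately have "F \<in> C" using maxchain_insert[OF C] by blast
    then show ?case using F(1) \<sigma>(2) by (auto simp: facet_of_def)
  qed
qed

text \<open>
  A maximal chain of a full-dimensional polytope has a face in each of the dimensions
  \<open>0, \<dots>, n\<close>, hence provides \<open>n + 1\<close> linearly independent vectors.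
\<close>
lemma maxchain_spans:
  fixes q :: "(real^'n) set \<Rightarrow> real \<times> (real^'n)"
  assumes P: "polytope P" and dim: "aff_dim P = int CARD('n)"
    and q: "\<And>\<sigma>. \<sigma> \<in> faces P \<Longrightarrow> q \<sigma> \<in> {1} \<times> rel_interior \<sigma>"
    and C: "subset.maxchain (faces P) C"
  obtains c where "(\<Sum>\<sigma>\<in>C. c \<sigma> *\<^sub>R q \<sigma>) = x"
proof -
  have ch: "subset.chain (faces P) C" using C by (rule subset.maxchain_imp_chain)
  then have "C \<subseteq> faces P" by (simp add: subset_chain_def)
  then have fin: "finite C" using finite_faces[OF P] finite_subset by blast
  have rel: "c \<sigma> = 0" if "(\<Sum>\<sigma>\<in>C. c \<sigma> *\<^sub>R q \<sigma>) = 0" "\<sigma> \<in> C" for c \<sigma>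
    using chain_relation_trivial[OF P q ch that] .
  have inj: "inj_on q C" using inj_on_chain[OF P q ch] .
  have ind: "independent (q ` C)"
  proof (rule independent_if_scalars_zero)
    fix c x assume "(\<Sum>x\<in>q ` C. c x *\<^sub>R x) = 0" and "x \<in> q ` C"
    then show "c x = 0" using rel[of "\<lambda>\<sigma>. c (q \<sigma>)"] inj by (auto simp: sum.reindex)
  qed (simp add: fin)
  have "{0..int CARD('n)} \<subseteq> aff_dim ` C"
    using maxchain_aff_dims[OF P C] dim by force
  then have "card {0..int CARD('n)} \<le> card C"
    using fin surj_card_le by blast
  then have "DIM(real \<times> (real^'n)) \<le> card (q ` C)" using inj by (simp add: card_image)
  then have "dim (q ` C) = DIM(real \<times> (real^'n))"
    using dim_eq_card_independent[OF ind] dim_subset_UNIV[of "q ` C"] by linarith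
  then have "span (q ` C) = UNIV" by (simp only: dim_eq_full)
  then have "x \<in> span (q ` C)" by simp
  then obtain u where "x = (\<Sum>v\<in>q ` C. u v *\<^sub>R v)" using span_finite[of "q ` C"] fin by auto
  then have "(\<Sum>\<sigma>\<in>C. u (q \<sigma>) *\<^sub>R q \<sigma>) = x" using inj by (simp add: sum.reindex)
  then show ?thesis using that[of "\<lambda>\<sigma>. u (q \<sigma>)"] by simp
qed

lemma chain_extends_to_maxchain:
  assumes "finite A" "subset.chain A C"
  obtains C' where "subset.maxchain A C'" "C \<subseteq> C'"
proof -
  have "finite {D. subset.chain A D \<and> C \<subseteq> D}"
    by (rule finite_subset[of _ "Pow A"]) (use assms(1) in \<open>auto simp: subset_chain_def\<close>)
  moreover have "C \<in> {D. subset.chain A D \<and> C \<subseteq> D}" using assms(2) by simp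
  ultimately obtain C' where C': "C' \<in> {D. subset.chain A D \<and> C \<subseteq> D}"
    "\<forall>D\<in>{D. subset.chain A D \<and> C \<subseteq> D}. C' \<subseteq> D \<longrightarrow> C' = D"
    using finite_has_maximal2[of "{D. subset.chain A D \<and> C \<subseteq> D}" C] by auto
  then have "subset.maxchain A C'" unfolding subset.maxchain_def by auto
  then show ?thesis using that C'(1) by simp
qed

text \<open>
  The simplices of the chains form a generalised barycentric subdivision of \<open>P\<close>.  The ray from the
  point \<open>p P\<close> through \<open>x\<close> leaves \<open>P\<close> at a point \<open>z\<close> of a proper face; the simplex of a chain of that
  face containing \<open>z\<close>, joined with \<open>p P\<close>, contains \<open>x\<close>.
\<close>
lemma point_in_chain_simplex:
  fixes p :: "(real^'n) set \<Rightarrow> real^'n"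
  assumes "polytope P" and "x \<in> P"
    and "\<And>\<sigma>. \<sigma> \<in> faces P \<Longrightarrow> p \<sigma> \<in> rel_interior \<sigma>"
  shows "\<exists>C. subset.chain (faces P) C \<and> x \<in> convex hull (p ` C)"
  using assms
proof (induction "nat (aff_dim P)" arbitrary: P x rule: less_induct)
  case less
  note P = less.prems(1) and x = less.prems(2) and p = less.prems(3)
  have conv: "convex P" using P by (rule polytope_imp_convex)
  have PA: "P \<in> faces P" using x conv by (auto simp: faces_def face_of_refl)
  show ?case
  proof (cases "x = p P")
    case True
    then show ?thesis using PA by (intro exI[of _ "{P}"]) (auto simp: subset_chain_def)
  next
    case False
    have pP: "p P \<in> rel_interior P" using p PA by blast
    then have pP': "p P \<in> P" using rel_interior_subset by blast
    have "p P + (x - p P) \<in> affine hull P" using x by (simp add: hull_inc)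
    then obtain d where d: "0 < d" "p P + d *\<^sub>R (x - p P) \<in> rel_frontier P"
      using ray_to_rel_frontier[OF polytope_imp_bounded[OF P] pP, of "x - p P"] False by auto
    define z where "z = p P + d *\<^sub>R (x - p P)"
    \<comment> \<open>The ray cannot leave \<open>P\<close> before reaching \<open>x\<close>, so \<open>x\<close> lies between \<open>p P\<close> and \<open>z\<close>.\<close>
    have "d \<ge> 1"
    proof (rule ccontr)
      assume "\<not> d \<ge> 1"
      then have "z \<in> open_segment (p P) x"
        using d(1) False unfolding in_segment z_def
        by (auto intro!: exI[of _ d] simp: algebra_simps)
      then have "z \<in> rel_interior P"
        using rel_interior_closure_convex_segment[OF conv pP] x closure_subset by blast
      then show False using d(2) by (simp add: rel_frontier_def z_def)
    qed
    obtain F where F: "F face_of P" "F \<noteq> P" "z \<in> F"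
      using d(2) rel_frontier_of_polyhedron_alt[OF polytope_imp_polyhedron[OF P]]
      unfolding z_def by blast
    have FA: "F \<in> faces P" using F by (auto simp: faces_def)
    have "aff_dim F < aff_dim P" using face_of_aff_dim_lt[OF conv F(1,2)] .
    moreover have "aff_dim F \<ge> 0" using F(3) aff_dim_negative_iff[of F] by (metis empty_iff not_less)
    ultimately obtain C where C: "subset.chain (faces F) C" "z \<in> convex hull (p ` C)"
      using less.hyps[of F z] face_of_polytope_polytope[OF P F(1)] F(3) p faces_trans[OF FA]
      by (auto simp: subset_iff)
    have "subset.chain (faces P) (insert P C)"
    proof -
      have "C \<subseteq> faces P" "\<And>\<tau>. \<tau> \<in> C \<Longrightarrow> \<tau> \<subseteq> P"
        using C(1) faces_trans[OF FA] faceD(3) unfolding subset_chain_def by blast+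
      then show ?thesis using C(1) PA by (simp add: subset_chain_def)
    qed
    moreover have "x \<in> convex hull (p ` insert P C)"
    proof -
      have "x = (1 - 1 / d) *\<^sub>R p P + (1 / d) *\<^sub>R z"
        using d(1) by (simp add: z_def algebra_simps)
      moreover have "p P \<in> convex hull (p ` insert P C)" by (simp add: hull_inc)
      moreover have "z \<in> convex hull (p ` insert P C)"
        using C(2) hull_mono[of "p ` C" "p ` insert P C"] by blast
      ultimately show ?thesis
        using \<open>d \<ge> 1\<close> convexD[OF convex_convex_hull, of "p P" _ z "1 - 1 / d" "1 / d"] by simp
    qed
    ultimately show ?thesis by blast
  qed
qed


section \<open>Rational coordinates\<close>

text \<open>
  Extend \<open>1\<close> to a basis of \<open>\<real>\<close> over \<open>\<rat>\<close> and project onto the coordinate at \<open>1\<close>.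
\<close>
lemma rational_retraction:
  obtains \<phi> :: "real \<Rightarrow> rat"
  where "\<And>x y. \<phi> (x + y) = \<phi> x + \<phi> y" "\<And>q x. \<phi> (of_rat q * x) = q * \<phi> x" "\<phi> 1 = 1"
proof -
  let ?s = "\<lambda>q (x::real). of_rat q * x" and ?t = "(*) :: rat \<Rightarrow> rat \<Rightarrow> rat"
  have s: "vector_space ?s" and t: "vector_space ?t"
    by unfold_locales (simp_all add: algebra_simps of_rat_add of_rat_mult)
  interpret VP: vector_space_pair ?s ?t
    using s t by (rule vector_space_pair.intro)
  have "\<not> VP.vs1.dependent {1}" by (simp add: VP.vs1.dependent_single)
  then obtain \<phi> where "Vector_Spaces.linear ?s ?t \<phi>" "\<forall>x\<in>{1}. \<phi> x = 1"
    using VP.linear_independent_extend[of "{1}" "\<lambda>_. 1"] by blast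
  then show ?thesis using that[of \<phi>] by (simp add: Vector_Spaces.linear_iff)
qed

text \<open>
  A \<open>\<rat>\<close>-linear retraction of \<open>\<real>\<close> onto \<open>\<rat>\<close>, applied to the coefficients of the relation, gives
  another expression of the same vector, since the entries of all the vectors are integers.  By
  uniqueness of the coefficients the retraction fixes them, so they are rational.
\<close>
lemma rational_coordinates:
  fixes w :: "'i \<Rightarrow> int \<times> (int^'n)" and c :: "'i \<Rightarrow> real"
  assumes indep: "\<And>b i. (\<Sum>i\<in>C. b i *\<^sub>R hat_emb (w i)) = 0 \<Longrightarrow> i \<in> C \<Longrightarrow> b i = 0"
    and rel: "(\<Sum>i\<in>C. c i *\<^sub>R hat_emb (w i)) = hat_emb x"
  shows "\<exists>a. \<forall>i\<in>C. c i = of_rat (a i)"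
proof -
  obtain \<phi> :: "real \<Rightarrow> rat" where \<phi>: "\<And>x y. \<phi> (x + y) = \<phi> x + \<phi> y"
    "\<And>q x. \<phi> (of_rat q * x) = q * \<phi> x" "\<phi> 1 = 1"
    using rational_retraction by blast
  have int: "\<phi> (x * of_int k) = \<phi> x * of_int k" for x k
    using \<phi>(2)[of "of_int k" x] by (simp add: mult.commute)
  have zero: "\<phi> 0 = 0" using \<phi>(2)[of 0 1] by simp
  have sum: "\<phi> (\<Sum>i\<in>C. h i) = (\<Sum>i\<in>C. \<phi> (h i))" for h
    by (induction C rule: infinite_finite_induct) (simp_all add: zero \<phi>(1))
  have red: "(\<Sum>i\<in>C. of_rat (\<phi> (c i)) * of_int (k i)) = (of_int k0 :: real)"
    if "(\<Sum>i\<in>C. c i * of_int (k i)) = of_int k0" for k k0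
  proof -
    have "(\<Sum>i\<in>C. \<phi> (c i) * of_int (k i)) = of_int k0"
      using arg_cong[OF that, of \<phi>] int[of 1 k0] \<phi>(3) by (simp add: sum int)
    then have "of_rat (\<Sum>i\<in>C. \<phi> (c i) * of_int (k i)) = (of_rat (of_int k0) :: real)" by simp
    then show ?thesis by (simp add: of_rat_sum of_rat_mult)
  qed
  have "(\<Sum>i\<in>C. of_rat (\<phi> (c i)) *\<^sub>R hat_emb (w i)) = hat_emb x"
  proof (rule prod_eqI)
    show "fst (\<Sum>i\<in>C. of_rat (\<phi> (c i)) *\<^sub>R hat_emb (w i)) = fst (hat_emb x)"
      using red[of "\<lambda>i. fst (w i)" "fst x"] arg_cong[OF rel, of fst] by (simp add: fst_sum hat_emb_def)
    show "snd (\<Sum>i\<in>C. of_rat (\<phi> (c i)) *\<^sub>R hat_emb (w i)) = snd (hat_emb x)"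
      using red[of "\<lambda>i. snd (w i) $ j" "snd x $ j" for j] arg_cong[OF rel, of snd]
      by (simp add: snd_sum hat_emb_def lat_emb_def vec_eq_iff)
  qed
  then have "(\<Sum>i\<in>C. (c i - of_rat (\<phi> (c i))) *\<^sub>R hat_emb (w i)) = 0"
    using rel by (simp add: scaleR_left_diff_distrib sum_subtractf)
  then have "c i = of_rat (\<phi> (c i))" if "i \<in> C" for i using indep[OF _ that] by force
  then show ?thesis by (intro exI[of _ "\<lambda>i. \<phi> (c i)"]) simp
qed

section \<open>Lexicographic minima\<close>

lemma linear_order_greatest:
  assumes r: "linear_order_on A r" and "finite T" "T \<noteq> {}" "T \<subseteq> A"
  obtains x where "x \<in> T" "\<And>y. y \<in> T \<Longrightarrow> (y, x) \<in> r"
proof -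
  have "refl_on A r" "trans r" "total_on A r"
    using r by (auto simp: order_on_defs)
  then have *: "(x, x) \<in> r" "(x, y) \<in> r \<or> (y, x) \<in> r" if "x \<in> A" "y \<in> A" for x y
    using that unfolding refl_on_def total_on_def by metis+
  have "\<exists>x\<in>T. \<forall>y\<in>T. (y, x) \<in> r"
    using assms(2-4)
  proof (induction T rule: finite_ne_induct)
    case (singleton x)
    then show ?case using * by blast
  next
    case (insert z T)
    then obtain x where x: "x \<in> T" "\<forall>y\<in>T. (y, x) \<in> r" by auto
    show ?case
    proof (cases "(z, x) \<in> r")
      case False
      then have "(x, z) \<in> r" using *(2)[of x z] x insert.prems by blast
      then show ?thesis using x(2) *(1)[of z] insert.prems transD[OF \<open>trans r\<close>] by blast
    qed (use x in blast)
  qed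
  then show ?thesis using that by blast
qed

lemma lex_less_asym:
  assumes r: "linearization P r" and "lex_less P r a b" "lex_less P r b a"
  shows False
proof -
  have tot: "total_on (faces P) r" using r by (simp add: linearization_def order_on_defs)
  obtain \<sigma> where \<sigma>: "\<sigma> \<in> faces P" "a \<sigma> < b \<sigma>"
    "\<And>\<tau>. \<tau> \<in> faces P \<Longrightarrow> (\<sigma>, \<tau>) \<in> r \<Longrightarrow> \<tau> \<noteq> \<sigma> \<Longrightarrow> a \<tau> = b \<tau>"
    using assms(2) by (auto simp: lex_less_def)
  obtain \<rho> where \<rho>: "\<rho> \<in> faces P" "b \<rho> < a \<rho>"
    "\<And>\<tau>. \<tau> \<in> faces P \<Longrightarrow> (\<rho>, \<tau>) \<in> r \<Longrightarrow> \<tau> \<noteq> \<rho> \<Longrightarrow> b \<tau> = a \<tau>"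
    using assms(3) by (auto simp: lex_less_def)
  have "\<sigma> \<noteq> \<rho>" using \<sigma>(2) \<rho>(2) by auto
  then have "(\<sigma>, \<rho>) \<in> r \<or> (\<rho>, \<sigma>) \<in> r" using tot \<sigma>(1) \<rho>(1) by (simp add: total_on_def)
  then show False using \<sigma> \<rho> \<open>\<sigma> \<noteq> \<rho>\<close> by (metis less_irrefl)
qed

lemma lex_min_eqI:
  assumes "linearization P r" "a \<in> S" "\<And>b. b \<in> S \<Longrightarrow> b \<noteq> a \<Longrightarrow> lex_less P r a b"
  shows "lex_min P r S = a"
  unfolding lex_min_def
proof (rule the_equality)
  fix a' assume a': "a' \<in> S \<and> (\<forall>b\<in>S. b \<noteq> a' \<longrightarrow> lex_less P r a' b)"
  show "a' = a"
  proof (rule ccontr)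
    assume "a' \<noteq> a"
    then have "lex_less P r a a'" "lex_less P r a' a" using a' assms(2,3) by auto
    then show False by (rule lex_less_asym[OF assms(1)])
  qed
qed (use assms in simp)


section \<open>Coordinates along maximal chains\<close>

text \<open>
  The points \<open>normalized_weight P (f \<sigma>)\<close> are the vertices of the simplices \<open>chain_simplex P f C\<close>.
  They differ from the weights of the \<open>f \<sigma>\<close> by the negative factors \<open>- 1 / cone_degree P (f \<sigma>)\<close>, so
  the geometry of the chains carries over to the weights.
\<close>
locale seshadri_stratified_polytope =
  fixes P :: "(real^'n) set"
    and X :: "(real^'n) set \<Rightarrow> ('n, 'k::field_char_0) vect set set"
    and f :: "(real^'n) set \<Rightarrow> ('n, 'k) cfun"
  assumes lattice: "lattice_polytope P"
    and full_dim: "aff_dim P = int CARD('n)"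
    and strat: "combinatorial_seshadri_stratification P X f"
begin

abbreviation vertex :: "(real^'n) set \<Rightarrow> real \<times> (real^'n)" where
  "vertex \<sigma> \<equiv> normalized_weight P (f \<sigma>)"

abbreviation coords :: "(real^'n) set set \<Rightarrow> ('n, 'k) cfun \<Rightarrow> 'n qvec" where
  "coords C g \<equiv> chain_coords P f C g"

lemma polytope: "polytope P"
  using lattice unfolding lattice_polytope_def polytope_def by blast

lemma has_lattice_point: "lattice_points P \<noteq> {}"
  using lattice_polytope_has_lattice_point[OF lattice] full_dim by force

lemma vertex_in_rel_interior: "\<sigma> \<in> faces P \<Longrightarrow> vertex \<sigma> \<in> {1} \<times> rel_interior \<sigma>"
  using strat by (simp add: combinatorial_seshadri_stratification_def)

lemma degree_pos: "\<sigma> \<in> faces P \<Longrightarrow> cone_degree P (f \<sigma>) > 0"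
  using strat by (force simp: combinatorial_seshadri_stratification_def)

lemma weight_vertex:
  "\<sigma> \<in> faces P \<Longrightarrow> hat_emb (weight P (f \<sigma>)) = - real (cone_degree P (f \<sigma>)) *\<^sub>R vertex \<sigma>"
  using degree_pos[of \<sigma>] by (simp add: normalized_weight_def)

lemma maxchain_faces:
  assumes "subset.maxchain (faces P) C"
  shows "subset.chain (faces P) C" "C \<subseteq> faces P" "finite C"
  using subset.maxchain_imp_chain[OF assms] finite_subset[OF _ finite_faces[OF polytope]]
  by (auto simp: subset_chain_def)

lemma weight_relation_trivial:
  assumes C: "subset.maxchain (faces P) C"
    and rel: "(\<Sum>\<sigma>\<in>C. b \<sigma> *\<^sub>R hat_emb (weight P (f \<sigma>))) = 0" and "\<sigma> \<in> C"
  shows "b \<sigma> = 0"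
proof -
  have "(\<Sum>\<sigma>\<in>C. (b \<sigma> * - real (cone_degree P (f \<sigma>))) *\<^sub>R vertex \<sigma>) =
      (\<Sum>\<sigma>\<in>C. b \<sigma> *\<^sub>R hat_emb (weight P (f \<sigma>)))"
    by (rule sum.cong) (use maxchain_faces(2)[OF C] weight_vertex in auto)
  then have "b \<sigma> * - real (cone_degree P (f \<sigma>)) = 0"
    using chain_relation_trivial[OF polytope vertex_in_rel_interior maxchain_faces(1)[OF C] _ \<open>\<sigma> \<in> C\<close>,
        of "\<lambda>\<sigma>. b \<sigma> * - real (cone_degree P (f \<sigma>))"] rel by simp
  then show ?thesis using degree_pos[of \<sigma>] \<open>\<sigma> \<in> C\<close> maxchain_faces(2)[OF C] by auto
qed

lemma coords_exist:
  assumes C: "subset.maxchain (faces P) C"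
  obtains a where "a \<in> qspace C" "hat_emb x = (\<Sum>\<sigma>\<in>C. of_rat (a \<sigma>) *\<^sub>R hat_emb (weight P (f \<sigma>)))"
proof -
  obtain c where c: "(\<Sum>\<sigma>\<in>C. c \<sigma> *\<^sub>R vertex \<sigma>) = hat_emb x"
    by (rule maxchain_spans[OF polytope full_dim vertex_in_rel_interior C])
  define b where "b \<sigma> = - c \<sigma> / real (cone_degree P (f \<sigma>))" for \<sigma>
  have "(\<Sum>\<sigma>\<in>C. b \<sigma> *\<^sub>R hat_emb (weight P (f \<sigma>))) = (\<Sum>\<sigma>\<in>C. c \<sigma> *\<^sub>R vertex \<sigma>)"
  proof (rule sum.cong)
    fix \<sigma> assume "\<sigma> \<in> C"
    then have "\<sigma> \<in> faces P" using maxchain_faces(2)[OF C] by blast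
    then show "b \<sigma> *\<^sub>R hat_emb (weight P (f \<sigma>)) = c \<sigma> *\<^sub>R vertex \<sigma>"
      using degree_pos[of \<sigma>] by (simp add: weight_vertex b_def)
  qed simp
  then have b: "(\<Sum>\<sigma>\<in>C. b \<sigma> *\<^sub>R hat_emb (weight P (f \<sigma>))) = hat_emb x" using c by simp
  have "\<exists>a. \<forall>\<sigma>\<in>C. b \<sigma> = of_rat (a \<sigma>)"
  proof (rule rational_coordinates)
    show "c \<sigma> = 0" if "(\<Sum>\<sigma>\<in>C. c \<sigma> *\<^sub>R hat_emb (weight P (f \<sigma>))) = 0" "\<sigma> \<in> C" for c \<sigma>
      using weight_relation_trivial[OF C that] .
  qed (rule b)
  then obtain a where a: "\<And>\<sigma>. \<sigma> \<in> C \<Longrightarrow> b \<sigma> = of_rat (a \<sigma>)" by blast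
  show ?thesis
  proof (rule that[of "\<lambda>\<sigma>. if \<sigma> \<in> C then a \<sigma> else 0"])
    show "hat_emb x = (\<Sum>\<sigma>\<in>C. of_rat (if \<sigma> \<in> C then a \<sigma> else 0) *\<^sub>R hat_emb (weight P (f \<sigma>)))"
      using b a by (auto cong: sum.cong)
  qed (simp add: qspace_def)
qed

text \<open>
  The weights along a maximal chain are a basis, and integral vectors have rational coordinates in
  it, so the coordinate vector is well defined.
\<close>
lemma coords_relation:
  assumes C: "subset.maxchain (faces P) C"
  shows "coords C g \<in> qspace C"
    and "hat_emb (weight P g) = (\<Sum>\<sigma>\<in>C. of_rat (coords C g \<sigma>) *\<^sub>R hat_emb (weight P (f \<sigma>)))"
proof -
  have "\<exists>!a. a \<in> qspace C \<and>
      hat_emb (weight P g) = (\<Sum>\<sigma>\<in>C. of_rat (a \<sigma>) *\<^sub>R hat_emb (weight P (f \<sigma>)))"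
  proof (rule ex_ex1I)
    show "\<exists>a. a \<in> qspace C \<and>
        hat_emb (weight P g) = (\<Sum>\<sigma>\<in>C. of_rat (a \<sigma>) *\<^sub>R hat_emb (weight P (f \<sigma>)))"
      by (rule coords_exist[OF C, of "weight P g"]) blast
  next
    fix a b :: "'n qvec"
    assume ab: "a \<in> qspace C \<and> hat_emb (weight P g) = (\<Sum>\<sigma>\<in>C. of_rat (a \<sigma>) *\<^sub>R hat_emb (weight P (f \<sigma>)))"
      "b \<in> qspace C \<and> hat_emb (weight P g) = (\<Sum>\<sigma>\<in>C. of_rat (b \<sigma>) *\<^sub>R hat_emb (weight P (f \<sigma>)))"
    show "a = b"
    proof
      fix \<sigma>
      have "(\<Sum>\<sigma>\<in>C. (of_rat (a \<sigma>) - of_rat (b \<sigma>)) *\<^sub>R hat_emb (weight P (f \<sigma>))) = 0"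
        using ab by (simp add: scaleR_left_diff_distrib sum_subtractf)
      from weight_relation_trivial[OF C this] show "a \<sigma> = b \<sigma>"
        using ab by (cases "\<sigma> \<in> C") (auto simp: qspace_def)
    qed
  qed
  from theI'[OF this] show "coords C g \<in> qspace C"
    and "hat_emb (weight P g) = (\<Sum>\<sigma>\<in>C. of_rat (coords C g \<sigma>) *\<^sub>R hat_emb (weight P (f \<sigma>)))"
    unfolding chain_coords_def by blast+
qed

lemma normalized_weight_coords:
  assumes C: "subset.maxchain (faces P) C"
  shows "normalized_weight P g =
    (\<Sum>\<sigma>\<in>C. (of_rat (coords C g \<sigma>) * real (cone_degree P (f \<sigma>)) / real (cone_degree P g)) *\<^sub>R vertex \<sigma>)"
proof -
  have "- hat_emb (weight P g) =
      (\<Sum>\<sigma>\<in>C. (of_rat (coords C g \<sigma>) * real (cone_degree P (f \<sigma>))) *\<^sub>R vertex \<sigma>)"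
    unfolding coords_relation(2)[OF C, of g] sum_negf[symmetric]
    by (rule sum.cong) (use maxchain_faces(2)[OF C] weight_vertex in auto)
  then show ?thesis
    unfolding normalized_weight_def[of P g] by (simp add: scaleR_sum_right)
qed

text \<open>
  Up to positive factors the coordinates of the weight are the coefficients of the normalized weight
  with respect to the vertices.  These sum to one because all points have height one, and they are
  unique because the vertices are independent, so they are barycentric coordinates.
\<close>
lemma in_simplex_iff_coords_nonneg:
  assumes C: "subset.maxchain (faces P) C" and g: "eigenfunction P g" "cone_degree P g \<ge> 1"
  shows "normalized_weight P g \<in> chain_simplex P f C \<longleftrightarrow> coords C g \<in> qspace_nonneg C"
proof -
  note ch = maxchain_faces[OF C]
  define b where "b \<sigma> = of_rat (coords C g \<sigma>) * real (cone_degree P (f \<sigma>)) / real (cone_degree P g)" for \<sigma>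
  have x: "normalized_weight P g = (\<Sum>\<sigma>\<in>C. b \<sigma> *\<^sub>R vertex \<sigma>)"
    unfolding b_def by (rule normalized_weight_coords[OF C])
  have b: "b \<sigma> \<ge> 0 \<longleftrightarrow> coords C g \<sigma> \<ge> 0" if "\<sigma> \<in> C" for \<sigma>
    using degree_pos[of \<sigma>] that ch(2) g(2)
    by (auto simp: b_def zero_le_mult_iff zero_le_divide_iff)
  have "normalized_weight P g \<in> chain_simplex P f C \<longleftrightarrow> (\<forall>\<sigma>\<in>C. b \<sigma> \<ge> 0)"
  proof
    assume "normalized_weight P g \<in> chain_simplex P f C"
    then obtain u where u: "\<And>y. y \<in> vertex ` C \<Longrightarrow> u y \<ge> 0"
      "(\<Sum>y\<in>vertex ` C. u y *\<^sub>R y) = normalized_weight P g"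
      unfolding chain_simplex_def convex_hull_finite[OF finite_imageI[OF ch(3)]] by blast
    have "inj_on vertex C" by (rule inj_on_chain[OF polytope vertex_in_rel_interior ch(1)])
    then have "(\<Sum>\<sigma>\<in>C. u (vertex \<sigma>) *\<^sub>R vertex \<sigma>) = (\<Sum>\<sigma>\<in>C. b \<sigma> *\<^sub>R vertex \<sigma>)"
      using u(2) x by (simp add: sum.reindex)
    then have rel: "(\<Sum>\<sigma>\<in>C. (u (vertex \<sigma>) - b \<sigma>) *\<^sub>R vertex \<sigma>) = 0"
      by (simp add: scaleR_left_diff_distrib sum_subtractf)
    show "\<forall>\<sigma>\<in>C. b \<sigma> \<ge> 0"
    proof
      fix \<sigma> assume "\<sigma> \<in> C"
      then show "b \<sigma> \<ge> 0"
        using chain_relation_trivial[OF polytope vertex_in_rel_interior ch(1) rel] u(1) by fastforce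
    qed
  next
    assume nonneg: "\<forall>\<sigma>\<in>C. b \<sigma> \<ge> 0"
    have "1 = fst (normalized_weight P g)"
      using normalized_weight_in_polytope[OF has_lattice_point polytope_imp_convex[OF polytope] g] by auto
    also have "\<dots> = (\<Sum>\<sigma>\<in>C. b \<sigma> * fst (vertex \<sigma>))" by (simp add: x fst_sum)
    also have "\<dots> = sum b C"
      by (rule sum.cong) (use vertex_in_rel_interior ch(2) in fastforce)+
    finally show "normalized_weight P g \<in> chain_simplex P f C"
      unfolding x chain_simplex_def
      by (intro convex_sum[OF ch(3) convex_convex_hull]) (use nonneg in \<open>auto intro: hull_inc\<close>)
  qed
  then show ?thesis using b coords_relation(1)[OF C, of g] by (auto simp: qspace_nonneg_def)
qed

lemma ex_maxchain_simplex:
  fixes g :: "('n, 'k) cfun"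
  assumes g: "eigenfunction P g" "cone_degree P g \<ge> 1"
  obtains C where "subset.maxchain (faces P) C" "normalized_weight P g \<in> chain_simplex P f C"
proof -
  have x: "normalized_weight P g \<in> {1} \<times> P"
    using normalized_weight_in_polytope[OF has_lattice_point polytope_imp_convex[OF polytope] g] .
  then obtain C where C: "subset.chain (faces P) C"
    "snd (normalized_weight P g) \<in> convex hull ((\<lambda>\<sigma>. snd (vertex \<sigma>)) ` C)"
    using point_in_chain_simplex[OF polytope, of "snd (normalized_weight P g)" "\<lambda>\<sigma>. snd (vertex \<sigma>)"]
      vertex_in_rel_interior by (auto simp: mem_Times_iff)
  obtain C' where C': "subset.maxchain (faces P) C'" "C \<subseteq> C'"
    by (rule chain_extends_to_maxchain[OF finite_faces[OF polytope] C(1)])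
  have "vertex ` C = {1} \<times> (\<lambda>\<sigma>. snd (vertex \<sigma>)) ` C"
  proof -
    have "vertex \<sigma> = (1, snd (vertex \<sigma>))" if "\<sigma> \<in> C" for \<sigma>
      using vertex_in_rel_interior[of \<sigma>] that C(1)
      by (auto simp: subset_chain_def prod_eq_iff mem_Times_iff)
    then have "vertex ` C = (\<lambda>\<sigma>. (1, snd (vertex \<sigma>))) ` C" by (rule image_cong[OF refl])
    also have "\<dots> = {1} \<times> (\<lambda>\<sigma>. snd (vertex \<sigma>)) ` C" by auto
    finally show ?thesis .
  qed
  then have "normalized_weight P g \<in> convex hull (vertex ` C)"
    using x C(2) by (simp add: convex_hull_Times mem_Times_iff)
  then have "normalized_weight P g \<in> chain_simplex P f C'"
    using hull_mono[OF image_mono[OF C'(2)], of convex vertex] unfolding chain_simplex_def by blast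
  then show ?thesis using that C'(1) by blast
qed

text \<open>
  Let \<open>\<sigma>\<close> be the topmost face at which the coordinates \<open>a\<close> along \<open>C\<close> and \<open>b\<close> along \<open>C'\<close> differ, and
  suppose \<open>b \<sigma> < a \<sigma>\<close>.  The faces of \<open>C'\<close> below \<open>\<sigma>\<close> in the linearization do not contain \<open>\<sigma>\<close>, so
  some functional vanishes at their vertices, is positive at the vertex of \<open>\<sigma>\<close> and nonnegative at
  all vertices.  Applied to the relation with coefficients \<open>a - b\<close> it yields a sum of nonnegative
  terms: a negative coefficient can occur only below \<open>\<sigma>\<close> at a face of \<open>C'\<close>, where the functional
  vanishes.  The term of \<open>\<sigma>\<close> is positive, which is a contradiction.
\<close>
lemma nonneg_coords_lex_least:
  assumes r: "linearization P r"
    and C: "subset.maxchain (faces P) C" and C': "subset.maxchain (faces P) C'"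
    and nonneg: "coords C g \<in> qspace_nonneg C" and neq: "coords C' g \<noteq> coords C g"
  shows "lex_less P r (coords C g) (coords C' g)"
proof -
  define a b where "a = coords C g" and "b = coords C' g"
  have fin: "finite (faces P)" using finite_faces[OF polytope] .
  have lin: "linear_order_on (faces P) r" using r by (simp add: linearization_def)
  then have anti: "antisym r" by (simp add: order_on_defs)
  have a0: "a \<sigma> = 0" if "\<sigma> \<notin> C" for \<sigma>
    using coords_relation(1)[OF C, of g] that by (simp add: qspace_def a_def)
  have b0: "b \<sigma> = 0" if "\<sigma> \<notin> C'" for \<sigma>
    using coords_relation(1)[OF C', of g] that by (simp add: qspace_def b_def)
  have an: "a \<sigma> \<ge> 0" for \<sigma>
    using nonneg a0[of \<sigma>] by (cases "\<sigma> \<in> C") (auto simp: qspace_nonneg_def a_def)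
  have CA: "C \<subseteq> faces P" "C' \<subseteq> faces P" using maxchain_faces(2) C C' by blast+
  let ?T = "{\<sigma> \<in> faces P. a \<sigma> \<noteq> b \<sigma>}"
  obtain \<rho> where "a \<rho> \<noteq> b \<rho>" using neq unfolding a_def b_def by (metis ext)
  moreover from this have "\<rho> \<in> C \<or> \<rho> \<in> C'" using a0[of \<rho>] b0[of \<rho>] by metis
  ultimately have "\<rho> \<in> ?T" using CA by blast
  then have T: "finite ?T" "?T \<noteq> {}" "?T \<subseteq> faces P" using fin by auto
  obtain \<sigma> where \<sigma>: "\<sigma> \<in> ?T" "\<And>\<tau>. \<tau> \<in> ?T \<Longrightarrow> (\<tau>, \<sigma>) \<in> r"
    by (rule linear_order_greatest[OF lin T]) blast
  have eq: "a \<tau> = b \<tau>" if "\<tau> \<in> faces P" "(\<sigma>, \<tau>) \<in> r" "\<tau> \<noteq> \<sigma>" for \<tau>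
    using \<sigma>(2)[of \<tau>] that antisymD[OF anti] by blast
  have "a \<sigma> < b \<sigma>"
  proof (rule ccontr)
    assume "\<not> a \<sigma> < b \<sigma>"
    then have gt: "a \<sigma> > b \<sigma>" using \<sigma>(1) by simp
    let ?D = "{\<tau> \<in> C'. (\<tau>, \<sigma>) \<in> r \<and> \<tau> \<noteq> \<sigma>}"
    have D: "subset.chain (faces P) ?D"
      using maxchain_faces(1)[OF C'] by (auto simp: subset_chain_def)
    have \<sigma>P: "\<sigma> \<in> faces P" using \<sigma>(1) by simp
    have above: "\<not> \<sigma> \<subseteq> \<tau>" if "\<tau> \<in> ?D" for \<tau>
    proof
      assume "\<sigma> \<subseteq> \<tau>"
      then have "(\<sigma>, \<tau>) \<in> r" using r \<sigma>P that CA unfolding linearization_def by blast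
      then show False using that antisymD[OF anti] by blast
    qed
    obtain y where y: "\<And>\<tau>. \<tau> \<in> ?D \<Longrightarrow> y \<bullet> vertex \<tau> = 0"
      "\<And>\<tau>. \<tau> \<in> faces P \<Longrightarrow> y \<bullet> vertex \<tau> \<ge> 0" "y \<bullet> vertex \<sigma> > 0"
      by (rule supporting_functional_of_chain[OF polytope vertex_in_rel_interior D \<sigma>P above]) auto
    \<comment> \<open>\<open>t \<tau>\<close> is minus the term of \<open>\<tau>\<close>, as weights are negative multiples of vertices.\<close>
    define t where "t \<tau> = of_rat (a \<tau> - b \<tau>) * (real (cone_degree P (f \<tau>)) * (y \<bullet> vertex \<tau>))" for \<tau>
    have "t \<tau> \<ge> 0" if \<tau>: "\<tau> \<in> faces P" for \<tau>
    proof -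
      consider "\<tau> = \<sigma>" | "\<tau> \<noteq> \<sigma>" "(\<sigma>, \<tau>) \<in> r" | "\<tau> \<in> ?D" | "\<tau> \<notin> C'"
        using lin \<tau> \<sigma>P unfolding linear_order_on_def total_on_def by blast
      then show ?thesis
      proof cases
        case 1
        then show ?thesis using gt y(3) by (simp add: t_def)
      next
        case 2
        then show ?thesis using eq[OF \<tau>] by (simp add: t_def)
      next
        case 3
        then show ?thesis using y(1) by (simp add: t_def)
      next
        case 4
        then show ?thesis using an[of \<tau>] b0[of \<tau>] y(2)[OF \<tau>] by (simp add: t_def)
      qed
    qed
    moreover have "t \<sigma> > 0" using gt y(3) degree_pos[OF \<sigma>P] by (simp add: t_def)
    ultimately have "sum t (faces P) > 0" using fin \<sigma>P by (intro sum_pos2[of _ \<sigma>]) auto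
    moreover have "sum t (faces P) = 0"
    proof -
      have ext: "hat_emb (weight P g) = (\<Sum>\<tau>\<in>faces P. of_rat (h \<tau>) *\<^sub>R hat_emb (weight P (f \<tau>)))"
        if "subset.maxchain (faces P) E" "h = coords E g" for E h
        unfolding coords_relation(2)[OF that(1), of g] that(2)
        by (rule sum.mono_neutral_left)
           (use fin maxchain_faces(2)[OF that(1)] coords_relation(1)[OF that(1), of g] in
             \<open>auto simp: qspace_def\<close>)
      have "(\<Sum>\<tau>\<in>faces P. of_rat (a \<tau> - b \<tau>) *\<^sub>R hat_emb (weight P (f \<tau>))) = 0"
        using ext[OF C a_def] ext[OF C' b_def]
        by (simp add: of_rat_diff scaleR_left_diff_distrib sum_subtractf)
      then have "0 = - (y \<bullet> (\<Sum>\<tau>\<in>faces P. of_rat (a \<tau> - b \<tau>) *\<^sub>R hat_emb (weight P (f \<tau>))))" by simp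
      also have "\<dots> = sum t (faces P)"
        unfolding inner_sum_right sum_negf[symmetric] t_def
        by (rule sum.cong) (simp_all add: weight_vertex)
      finally show ?thesis by simp
    qed
    ultimately show False by simp
  qed
  then show ?thesis using \<sigma>(1) eq unfolding lex_less_def a_def b_def by blast
qed

lemma chain_valuation_eigenfunction:
  assumes "linearization P r" "eigenfunction P g"
  shows "chain_valuation P f r C g = coords C g"
  unfolding chain_valuation_def weight_components_eigenfunction[OF assms(2)]
  by (rule lex_min_eqI[OF assms(1)]) auto

lemma quasi_valuation_eq_coords:
  assumes r: "linearization P r" and g: "eigenfunction P g" "cone_degree P g \<ge> 1"
    and C: "subset.maxchain (faces P) C" "normalized_weight P g \<in> chain_simplex P f C"
  shows "quasi_valuation P f r g = coords C g"
  unfolding quasi_valuation_def chain_valuation_eigenfunction[OF r g(1)]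
  using nonneg_coords_lex_least[OF r C(1)] in_simplex_iff_coords_nonneg[OF C(1) g] C
  by (intro lex_min_eqI[OF r]) auto

end

theorem proposition4p5:
  fixes P :: "(real^'n) set"
    and X :: "(real^'n) set \<Rightarrow> ('n, 'k::{alg_closed_field, field_char_0}) vect set set"
    and f :: "(real^'n) set \<Rightarrow> ('n, 'k) cfun"
    and r :: "(real^'n) set rel"
    and g :: "('n, 'k) cfun"
  assumes "normal_lattice_polytope P"
    and "aff_dim P = int CARD('n)"
    and "combinatorial_seshadri_stratification P X f"
    and "linearization P r"
    and "eigenfunction P g"
    and "cone_degree P g \<ge> 1"
  shows "(\<forall>C. subset.maxchain (faces P) C \<longrightarrow>
            (quasi_valuation P f r g = chain_valuation P f r C g
               \<longleftrightarrow> normalized_weight P g \<in> chain_simplex P f C) \<and>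
            (normalized_weight P g \<in> chain_simplex P f C
               \<longleftrightarrow> chain_valuation P f r C g \<in> qspace_nonneg C)) \<and>
         quasi_valuation P f r g \<in> qspace_nonneg (faces P) \<and>
         (\<forall>r'. linearization P r' \<longrightarrow> quasi_valuation P f r' g = quasi_valuation P f r g)"
proof -
  interpret seshadri_stratified_polytope P X f
    using assms(1-3) by unfold_locales (simp_all add: normal_lattice_polytope_def)
  note r = assms(4) and g = assms(5,6)
  \<comment> \<open>The valuation is computed by any chain whose simplex contains the point, for every linearization.\<close>
  obtain C0 where C0: "subset.maxchain (faces P) C0" "normalized_weight P g \<in> chain_simplex P f C0"
    by (rule ex_maxchain_simplex[OF g])
  have val: "quasi_valuation P f r' g = coords C0 g" if "linearization P r'" for r'
    using quasi_valuation_eq_coords[OF that g C0] .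
  have C0_nonneg: "coords C0 g \<in> qspace_nonneg C0"
    using in_simplex_iff_coords_nonneg[OF C0(1) g] C0(2) by simp
  then have nonneg: "coords C0 g \<sigma> \<ge> 0" for \<sigma>
    by (cases "\<sigma> \<in> C0") (auto simp: qspace_nonneg_def qspace_def)
  have "quasi_valuation P f r g = coords C g \<longleftrightarrow> normalized_weight P g \<in> chain_simplex P f C"
    if C: "subset.maxchain (faces P) C" for C
  proof
    assume "quasi_valuation P f r g = coords C g"
    then have "coords C g = coords C0 g" using val[OF r] by simp
    then have "coords C g \<in> qspace_nonneg C"
      using coords_relation(1)[OF C, of g] nonneg by (simp add: qspace_nonneg_def)
    then show "normalized_weight P g \<in> chain_simplex P f C"
      using in_simplex_iff_coords_nonneg[OF C g] by simp
  qed (use quasi_valuation_eq_coords[OF r g C] in blast)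
  moreover have "quasi_valuation P f r g \<in> qspace_nonneg (faces P)"
    using C0_nonneg nonneg maxchain_faces(2)[OF C0(1)]
    by (auto simp: val[OF r] qspace_nonneg_def qspace_def)
  ultimately show ?thesis
    using in_simplex_iff_coords_nonneg[OF _ g] val r
    by (simp add: chain_valuation_eigenfunction[OF r g(1)])
qed

end
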